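(* Let $E$ be a weighted graph and let $C$ be an equivalence class of the relation $\leftrightharpoons$ on the objects of $\mathbf{RG}(E)$. Fix $(F,\phi)\in C$ and $u\in F^0$, and let $(T_C,\xi_C)$ be the representation graph constructed from $(F,\phi)$ and $u$. Then, up to isomorphism, the representation graphs in $C$ are precisely the quotients of $(T_C,\xi_C)$. Consequently, $(S_C,\zeta_C):=((T_C)_\sim,(\xi_C)_\sim)$ is, up to isomorphism, the unique irreducible representation graph in $C$.
   Context: Graphs: a directed graph $E=(E^0,E^1,r,s)$ consists of sets $E^0,E^1$ and maps $r,s:E^1\to E^0$ (range, source). All graphs are row-finite ($s^{-1}(v)$ finite for every vertex $v$). A weighted graph is such a graph $E$ with a map $w:E^1\to\mathbb N=\{1,2,\dots\}$. For $v\in E^0$, $w(v)=\max\{w(e)\mid e\in s^{-1}(v)\}$, and $w(v)=0$ if $v$ is a sink. The directed graph $\hat E$ has $\hat E^0=E^0$, $\hat E^1=\{e_1,\dots,e_{w(e)}\mid e\in E^1\}$, $\hat s(e_i)=s(e)$, $\hat r(e_i)=r(e)$; $\mathrm{tag}(e_i)=i$, $\mathrm{st}(e_i)=e$. Representation graphs: a representation graph of $E$ is a pair $(F,\phi)$, $F$ a directed graph and $\phi=(\phi^0,\phi^1):F\to\hat E$ a homomorphism of directed graphs, such that (1) for any $v\in F^0$ and $1\le i\le w(\phi^0(v))$ there is precisely one $f\in s_F^{-1}(v)$ with $\mathrm{tag}(\phi^1(f))=i$; (2) for any $v\in F^0$ and $e\in r^{-1}(\phi^0(v))$ there is precisely one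 $f\in r_F^{-1}(v)$ with $\mathrm{st}(\phi^1(f))=e$. Paths: the double graph $G_d$ of a directed graph $G$ is obtained by adding a reversed edge $g^*$ for each edge $g$ (with $(g^* )^*=g$). $\mathrm{Path}(G)$ is the set of finite paths of $G$ (vertices are paths of length $0$); ${}_u\mathrm{Path}(G)$ is the set of those starting at $u$, ${}_u\mathrm{Path}_v(G)$ those from $u$ to $v$. $\phi$ induces a map $\phi:\mathrm{Path}(F_d)\to\mathrm{Path}(\hat E_d)$. $F$ is connected if ${}_u\mathrm{Path}_v(F_d)\ne\emptyset$ for all $u,v\in F^0$. $(F,\phi)$ is irreducible if $F$ is connected and $\phi({}_u\mathrm{Path}(F_d))\ne\phi({}_v\mathrm{Path}(F_d))$ for any $u\ne v$ in $F^0$. A path in $G_d$ is reduced if it contains no subword $gg^*$ or $g^*g$ with $g\in G^1$. Category: $\mathbf{RG}(E)$ is the category of nonempty connected representation graphs of $E$; a morphism $\alpha:(F,\phi)\to(G,\psi)$ is a homomorphism $\alpha:F\to G$ of directed graphs with $\psi\alpha=\phi$. Write $(F,\phi)\leftrightharpoons(G,\psi)$ if there are $u\in F^0$, $v\in G^0$ with $\phi({}_u\mathrm{Path}(F_d))=\psi({}_v\mathrm{Path}(G_d))$; this is an equivalence relation. Quotients: for $(F,\phi)\in\mathbf{RG}(E)$ and $u,v\in F^0$ put $u\sim v$ iff $\phi({}_u\mathrm{Path}(F_d))=\phi({}_v\mathrm{Path}(F_d))$. An equivalence relation $\approx$ on $F^0$ is admissible if (1) $u\approx v$ implies $u\sim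 v$; (2) if $u\approx v$, $p\in{}_u\mathrm{Path}_x(F_d)$, $q\in{}_v\mathrm{Path}_y(F_d)$ and $\phi(p)=\phi(q)$, then $x\approx y$. ($\sim$ is itself admissible.) For admissible $\approx$ and $f,g\in F^1$ put $f\approx g$ iff $s(f)\approx s(g)$ and $\phi(f)=\phi(g)$. The quotient $(F_\approx,\phi_\approx)$ is the representation graph with $F_\approx^0=F^0/{\approx}$, $F_\approx^1=F^1/{\approx}$, $s([f])=[s(f)]$, $r([f])=[r(f)]$, $\phi_\approx^0([v])=\phi^0(v)$, $\phi^1_\approx([f])=\phi^1(f)$. A quotient of $(F,\phi)$ is any $(F_\approx,\phi_\approx)$ with $\approx$ admissible. Construction of $(T_C,\xi_C)=(T,\xi)$: let $P=\phi({}_u\mathrm{Path}(F_d))_{\mathrm{nb}}$ be the set of reduced paths in $\phi({}_u\mathrm{Path}(F_d))\subseteq\mathrm{Path}(\hat E_d)$. Put $T^0=\{v_p\mid p\in P\}$, $T^1=\{e_p\mid p\in P, p\ne\phi(u)\}$. For $p=x_1\cdots x_n\in P$ of length $n\ge1$ (with $x_1\cdots x_{n-1}:=\phi(u)$ if $n=1$): if $x_n\in\hat E^1$, then $s(e_p)=v_{x_1\cdots x_{n-1}}$, $r(e_p)=v_p$, $\xi^1(e_p)=x_n$; if $x_n\in(\hat E^1)^*$, then $s(e_p)=v_p$, $r(e_p)=v_{x_1\cdots x_{n-1}}$, $\xi^1(e_p)=x_n^*$. Further $\xi^0(v_p)$ is the endpoint of $p$ in $\hat E_d$ (so $\xi^0(v_{\phi(u)})=\phi(u)$).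 *)

theory Defs
  imports "Graph_Theory.Arc_Walk"
begin

definition row_finite :: "('a, 'b) pre_digraph \<Rightarrow> bool" where
  "row_finite G \<longleftrightarrow> (\<forall>v\<in>verts G. finite (out_arcs G v))"

locale weighted_graph = wf_digraph E for E :: "('v, 'e) pre_digraph" +
  fixes w :: "'e \<Rightarrow> nat"
  assumes row_finite_E: "row_finite E"
    and weight_pos: "e \<in> arcs E \<Longrightarrow> w e \<ge> 1"

definition vweight :: "('v, 'e) pre_digraph \<Rightarrow> ('e \<Rightarrow> nat) \<Rightarrow> 'v \<Rightarrow> nat" where
  "vweight E w v = (if out_arcs E v = {} then 0 else Max (w ` out_arcs E v))"

text \<open>The edge \<open>e\<^sub>i\<close> of the unfolded graph is encoded as the pair \<open>(e, i)\<close>.\<close>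

type_synonym 'e tedge = "'e \<times> nat"

abbreviation st :: "'e tedge \<Rightarrow> 'e" where "st \<equiv> fst"
abbreviation tag :: "'e tedge \<Rightarrow> nat" where "tag \<equiv> snd"

definition hat :: "('v, 'e) pre_digraph \<Rightarrow> ('e \<Rightarrow> nat) \<Rightarrow> ('v, 'e tedge) pre_digraph" where
  "hat E w = \<lparr>verts = verts E,
     arcs = {(e, i). e \<in> arcs E \<and> 1 \<le> i \<and> i \<le> w e},
     tail = (\<lambda>x. tail E (st x)),
     head = (\<lambda>x. head E (st x))\<rparr>"

datatype 'b dedge = Fwd 'b | Rev 'b

definition double :: "('a, 'b) pre_digraph \<Rightarrow> ('a, 'b dedge) pre_digraph" where
  "double G = \<lparr>verts = verts G,
     arcs = Fwd ` arcs G \<union> Rev ` arcs G,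
     tail = case_dedge (tail G) (head G),
     head = case_dedge (head G) (tail G)\<rparr>"

text \<open>A path is its initial vertex together with its list of edges, so that the
  paths of length \<open>0\<close> are the pairs \<open>(v, [])\<close>.\<close>

type_synonym ('a, 'b) path = "'a \<times> 'b list"

definition paths_between :: "('a, 'b) pre_digraph \<Rightarrow> 'a \<Rightarrow> 'a \<Rightarrow> ('a, 'b) path set" where
  "paths_between G u v = {(u, p) | p. pre_digraph.awalk G u p v}"

definition paths_from :: "('a, 'b) pre_digraph \<Rightarrow> 'a \<Rightarrow> ('a, 'b) path set" where
  "paths_from G u = (\<Union>v\<in>verts G. paths_between G u v)"

definition connected_graph :: "('a, 'b) pre_digraph \<Rightarrow> bool" where
  "connected_graph G \<longleftrightarrow> (\<forall>u\<in>verts G. \<forall>v\<in>verts G. paths_between (double G) u v \<noteq> {})"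

definition reduced :: "('a, 'b) pre_digraph \<Rightarrow> ('a, 'b dedge) path \<Rightarrow> bool" where
  "reduced G p \<longleftrightarrow> \<not> (\<exists>xs ys. \<exists>g\<in>arcs G.
     snd p = xs @ [Fwd g, Rev g] @ ys \<or> snd p = xs @ [Rev g, Fwd g] @ ys)"

definition graph_hom ::
  "('a, 'b) pre_digraph \<Rightarrow> ('c, 'd) pre_digraph \<Rightarrow> ('a \<Rightarrow> 'c) \<Rightarrow> ('b \<Rightarrow> 'd) \<Rightarrow> bool" where
  "graph_hom G H \<alpha>0 \<alpha>1 \<longleftrightarrow>
     (\<forall>v\<in>verts G. \<alpha>0 v \<in> verts H) \<and>
     (\<forall>f\<in>arcs G. \<alpha>1 f \<in> arcs H \<and> tail H (\<alpha>1 f) = \<alpha>0 (tail G f) \<and> head H (\<alpha>1 f) = \<alpha>0 (head G f))"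

text \<open>A graph \<open>F\<close> together with the two components \<open>vmap = \<phi>\<^sup>0\<close> and \<open>amap = \<phi>\<^sup>1\<close> of
  a map from \<open>F\<close> to the unfolded graph; only their values on \<open>verts\<close> and \<open>arcs\<close> matter.\<close>

record ('a, 'b, 'v, 'e) repgraph =
  gr :: "('a, 'b) pre_digraph"
  vmap :: "'a \<Rightarrow> 'v"
  amap :: "'b \<Rightarrow> 'e tedge"

definition representation_graph ::
  "('v, 'e) pre_digraph \<Rightarrow> ('e \<Rightarrow> nat) \<Rightarrow> ('a, 'b, 'v, 'e) repgraph \<Rightarrow> bool" where
  "representation_graph E w F \<longleftrightarrow>
     wf_digraph (gr F) \<and> row_finite (gr F) \<and>
     graph_hom (gr F) (hat E w) (vmap F) (amap F) \<and>
     (\<forall>v\<in>verts (gr F). \<forall>i. 1 \<le> i \<and> i \<le> vweight E w (vmap F v) \<longrightarrow>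
        (\<exists>!f. f \<in> out_arcs (gr F) v \<and> tag (amap F f) = i)) \<and>
     (\<forall>v\<in>verts (gr F). \<forall>e\<in>in_arcs E (vmap F v).
        (\<exists>!f. f \<in> in_arcs (gr F) v \<and> st (amap F f) = e))"

definition RG ::
  "('v, 'e) pre_digraph \<Rightarrow> ('e \<Rightarrow> nat) \<Rightarrow> ('a, 'b, 'v, 'e) repgraph set" where
  "RG E w = {F. representation_graph E w F \<and> verts (gr F) \<noteq> {} \<and> connected_graph (gr F)}"

definition path_map ::
  "('a, 'b, 'v, 'e) repgraph \<Rightarrow> ('a, 'b dedge) path \<Rightarrow> ('v, 'e tedge dedge) path" where
  "path_map F = map_prod (vmap F) (map (map_dedge (amap F)))"

definition path_image ::
  "('a, 'b, 'v, 'e) repgraph \<Rightarrow> 'a \<Rightarrow> ('v, 'e tedge dedge) path set" where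
  "path_image F u = path_map F ` paths_from (double (gr F)) u"

definition irreducible_rep :: "('a, 'b, 'v, 'e) repgraph \<Rightarrow> bool" where
  "irreducible_rep F \<longleftrightarrow> connected_graph (gr F) \<and>
     (\<forall>u\<in>verts (gr F). \<forall>v\<in>verts (gr F). u \<noteq> v \<longrightarrow> path_image F u \<noteq> path_image F v)"

definition rep_morphism ::
  "('a, 'b, 'v, 'e) repgraph \<Rightarrow> ('c, 'd, 'v, 'e) repgraph \<Rightarrow> ('a \<Rightarrow> 'c) \<Rightarrow> ('b \<Rightarrow> 'd) \<Rightarrow> bool" where
  "rep_morphism F G \<alpha>0 \<alpha>1 \<longleftrightarrow> graph_hom (gr F) (gr G) \<alpha>0 \<alpha>1 \<and>
     (\<forall>v\<in>verts (gr F). vmap G (\<alpha>0 v) = vmap F v) \<and>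
     (\<forall>f\<in>arcs (gr F). amap G (\<alpha>1 f) = amap F f)"

definition rep_iso ::
  "('a, 'b, 'v, 'e) repgraph \<Rightarrow> ('c, 'd, 'v, 'e) repgraph \<Rightarrow> bool" where
  "rep_iso F G \<longleftrightarrow> (\<exists>\<alpha>0 \<alpha>1 \<beta>0 \<beta>1. rep_morphism F G \<alpha>0 \<alpha>1 \<and> rep_morphism G F \<beta>0 \<beta>1 \<and>
     (\<forall>v\<in>verts (gr F). \<beta>0 (\<alpha>0 v) = v) \<and> (\<forall>f\<in>arcs (gr F). \<beta>1 (\<alpha>1 f) = f) \<and>
     (\<forall>v\<in>verts (gr G). \<alpha>0 (\<beta>0 v) = v) \<and> (\<forall>f\<in>arcs (gr G). \<alpha>1 (\<beta>1 f) = f))"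

definition rep_equiv ::
  "('a, 'b, 'v, 'e) repgraph \<Rightarrow> ('c, 'd, 'v, 'e) repgraph \<Rightarrow> bool" (infix \<open>\<leftrightharpoons>\<close> 50) where
  "F \<leftrightharpoons> G \<longleftrightarrow> (\<exists>u\<in>verts (gr F). \<exists>v\<in>verts (gr G). path_image F u = path_image G v)"

definition rep_equiv_rel ::
  "('v, 'e) pre_digraph \<Rightarrow> ('e \<Rightarrow> nat) \<Rightarrow>
   (('a, 'b, 'v, 'e) repgraph \<times> ('a, 'b, 'v, 'e) repgraph) set" where
  "rep_equiv_rel E w = {(F, G). F \<in> RG E w \<and> G \<in> RG E w \<and> F \<leftrightharpoons> G}"

text \<open>An equivalence class, viewed as a set \<open>C\<close>, only contains graphs over one fixed pair of
  vertex and edge types. The following set consists of the members of the class of \<open>C\<close>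
  with vertices and edges of arbitrary types (possibly different from those of \<open>C\<close>).\<close>

definition class_members ::
  "('v, 'e) pre_digraph \<Rightarrow> ('e \<Rightarrow> nat) \<Rightarrow> ('a, 'b, 'v, 'e) repgraph set \<Rightarrow>
   ('c, 'd, 'v, 'e) repgraph set" where
  "class_members E w C = {G \<in> RG E w. \<exists>F\<in>C. F \<leftrightharpoons> G}"

definition sim :: "('a, 'b, 'v, 'e) repgraph \<Rightarrow> 'a rel" where
  "sim F = {(u, v). u \<in> verts (gr F) \<and> v \<in> verts (gr F) \<and> path_image F u = path_image F v}"

definition admissible :: "('a, 'b, 'v, 'e) repgraph \<Rightarrow> 'a rel \<Rightarrow> bool" where
  "admissible F R \<longleftrightarrow> equiv (verts (gr F)) R \<and> R \<subseteq> sim F \<and>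
     (\<forall>u v x y. \<forall>p\<in>paths_between (double (gr F)) u x. \<forall>q\<in>paths_between (double (gr F)) v y.
        (u, v) \<in> R \<and> path_map F p = path_map F q \<longrightarrow> (x, y) \<in> R)"

definition arc_rel :: "('a, 'b, 'v, 'e) repgraph \<Rightarrow> 'a rel \<Rightarrow> 'b rel" where
  "arc_rel F R = {(f, g). f \<in> arcs (gr F) \<and> g \<in> arcs (gr F) \<and>
     (tail (gr F) f, tail (gr F) g) \<in> R \<and> amap F f = amap F g}"

text \<open>For a class \<open>A = [f]\<close> of edges, \<open>R `` (tail (gr F) ` A)\<close> is the union of the classes
  \<open>[s(g)]\<close> with \<open>g \<in> A\<close>. These all coincide with \<open>[s(f)]\<close>, and likewise for the ranges and the
  values of \<open>vmap\<close> and \<open>amap\<close>; see the lemmas below.\<close>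

definition quotient_rep ::
  "('a, 'b, 'v, 'e) repgraph \<Rightarrow> 'a rel \<Rightarrow> ('a set, 'b set, 'v, 'e) repgraph" where
  "quotient_rep F R = \<lparr>
     gr = \<lparr>verts = verts (gr F) // R,
           arcs = arcs (gr F) // arc_rel F R,
           tail = (\<lambda>A. R `` (tail (gr F) ` A)),
           head = (\<lambda>A. R `` (head (gr F) ` A))\<rparr>,
     vmap = (\<lambda>A. the_elem (vmap F ` A)),
     amap = (\<lambda>A. the_elem (amap F ` A))\<rparr>"

definition quotients ::
  "('a, 'b, 'v, 'e) repgraph \<Rightarrow> ('a set, 'b set, 'v, 'e) repgraph set" where
  "quotients F = {quotient_rep F R | R. admissible F R}"

lemma path_image_Nil:
  assumes "v \<in> verts (gr F)"
  shows "(vmap F v, []) \<in> path_image F v"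
proof -
  have "pre_digraph.awalk (double (gr F)) v [] v"
    using assms by (simp add: pre_digraph.awalk_def pre_digraph.cas.simps double_def)
  then have "(v, []) \<in> paths_between (double (gr F)) v v"
    unfolding paths_between_def by blast
  moreover have "v \<in> verts (double (gr F))"
    using assms by (simp add: double_def)
  ultimately have "(v, []) \<in> paths_from (double (gr F)) v"
    unfolding paths_from_def by blast
  then have "path_map F (v, []) \<in> path_image F v"
    unfolding path_image_def by (rule imageI)
  then show ?thesis by (simp add: path_map_def)
qed

lemma fst_path_image: "p \<in> path_image F v \<Longrightarrow> fst p = vmap F v"
  unfolding path_image_def path_map_def paths_from_def paths_between_def by force

lemma sim_vmap:
  assumes "(u, v) \<in> sim F"
  shows "vmap F u = vmap F v"
proof -
  have "u \<in> verts (gr F)" "path_image F u = path_image F v"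
    using assms by (simp_all add: sim_def)
  then have "(vmap F u, []) \<in> path_image F v"
    using path_image_Nil[of u F] by simp
  then show ?thesis using fst_path_image[of "(vmap F u, [])" F v] by simp
qed

lemma admissible_equiv: "admissible F R \<Longrightarrow> equiv (verts (gr F)) R"
  unfolding admissible_def by (rule conjunct1)

lemma admissible_sim: "admissible F R \<Longrightarrow> (u, v) \<in> R \<Longrightarrow> (u, v) \<in> sim F"
  unfolding admissible_def by (meson subsetD)

lemma arc_rel_refl:
  assumes "equiv (verts (gr F)) R" "f \<in> arcs (gr F)" "wf_digraph (gr F)"
  shows "f \<in> arc_rel F R `` {f}"
proof -
  have "tail (gr F) f \<in> verts (gr F)"
    using assms by (simp add: wf_digraph.tail_in_verts)
  then have "(tail (gr F) f, tail (gr F) f) \<in> R"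
    using assms(1) by (meson equiv_def refl_on_def)
  then show ?thesis using assms(2) by (simp add: arc_rel_def)
qed

lemma Image_image_const:
  assumes "a \<in> A" "\<And>g. g \<in> A \<Longrightarrow> R `` {h g} = R `` {h a}"
  shows "R `` (h ` A) = R `` {h a}"
proof -
  have "R `` (h ` A) = (\<Union>g\<in>A. R `` {h g})" by blast
  also have "\<dots> = (\<Union>g\<in>A. R `` {h a})" by (rule SUP_cong[OF refl assms(2)])
  also have "\<dots> = R `` {h a}" using assms(1) by blast
  finally show ?thesis .
qed

lemma quotient_rep_tail:
  assumes "equiv (verts (gr F)) R" "f \<in> arcs (gr F)" "wf_digraph (gr F)"
  shows "tail (gr (quotient_rep F R)) (arc_rel F R `` {f}) = R `` {tail (gr F) f}"
proof -
  have "R `` {tail (gr F) g} = R `` {tail (gr F) f}" if "g \<in> arc_rel F R `` {f}" for g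
  proof -
    have "(tail (gr F) f, tail (gr F) g) \<in> R" using that by (simp add: arc_rel_def)
    then show ?thesis by (rule equiv_class_eq[OF assms(1), symmetric])
  qed
  then have "R `` (tail (gr F) ` (arc_rel F R `` {f})) = R `` {tail (gr F) f}"
    by (rule Image_image_const[OF arc_rel_refl[OF assms]])
  then show ?thesis by (simp only: quotient_rep_def repgraph.simps pre_digraph.simps)
qed

lemma quotient_rep_head:
  assumes "admissible F R" "f \<in> arcs (gr F)" "wf_digraph (gr F)"
  shows "head (gr (quotient_rep F R)) (arc_rel F R `` {f}) = R `` {head (gr F) f}"
proof -
  note eq = admissible_equiv[OF assms(1)]
  have edge: "(tail (gr F) h, [Fwd h]) \<in> paths_between (double (gr F)) (tail (gr F) h) (head (gr F) h)"
    if "h \<in> arcs (gr F)" for h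
    using that assms(3)
    by (simp add: paths_between_def double_def pre_digraph.awalk_def pre_digraph.cas.simps
        wf_digraph.tail_in_verts)
  have "R `` {head (gr F) g} = R `` {head (gr F) f}" if "g \<in> arc_rel F R `` {f}" for g
  proof -
    have g: "g \<in> arcs (gr F)" "(tail (gr F) f, tail (gr F) g) \<in> R" "amap F f = amap F g"
      using that by (simp_all add: arc_rel_def)
    have "vmap F (tail (gr F) f) = vmap F (tail (gr F) g)"
      using sim_vmap[OF admissible_sim[OF assms(1) g(2)]] .
    then have "path_map F (tail (gr F) f, [Fwd f]) = path_map F (tail (gr F) g, [Fwd g])"
      using g(3) by (simp add: path_map_def)
    then have "(head (gr F) f, head (gr F) g) \<in> R"
      using assms(1) g(2) edge[OF assms(2)] edge[OF g(1)] unfolding admissible_def by meson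
    then show ?thesis by (rule equiv_class_eq[OF eq, symmetric])
  qed
  then have "R `` (head (gr F) ` (arc_rel F R `` {f})) = R `` {head (gr F) f}"
    by (rule Image_image_const[OF arc_rel_refl[OF eq assms(2,3)]])
  then show ?thesis by (simp only: quotient_rep_def repgraph.simps pre_digraph.simps)
qed

lemma quotient_rep_vmap:
  assumes "admissible F R" "v \<in> verts (gr F)"
  shows "vmap (quotient_rep F R) (R `` {v}) = vmap F v"
proof -
  have "vmap F x = vmap F v" if "x \<in> R `` {v}" for x
    using sim_vmap[OF admissible_sim[OF assms(1), of v x]] that by simp
  moreover have "v \<in> R `` {v}"
    by (rule equiv_class_self[OF admissible_equiv[OF assms(1)] assms(2)])
  ultimately have "vmap F ` (R `` {v}) = {vmap F v}" by blast
  then show ?thesis by (simp add: quotient_rep_def)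
qed

lemma quotient_rep_amap:
  assumes "equiv (verts (gr F)) R" "f \<in> arcs (gr F)" "wf_digraph (gr F)"
  shows "amap (quotient_rep F R) (arc_rel F R `` {f}) = amap F f"
proof -
  have "amap F g = amap F f" if "g \<in> arc_rel F R `` {f}" for g
    using that by (simp add: arc_rel_def)
  then have "amap F ` (arc_rel F R `` {f}) = {amap F f}"
    using arc_rel_refl[OF assms] by blast
  then show ?thesis by (simp add: quotient_rep_def)
qed

definition reduced_image ::
  "('v, 'e) pre_digraph \<Rightarrow> ('e \<Rightarrow> nat) \<Rightarrow> ('a, 'b, 'v, 'e) repgraph \<Rightarrow> 'a \<Rightarrow>
   ('v, 'e tedge dedge) path set" where
  "reduced_image E w F u = {p \<in> path_image F u. reduced (hat E w) p}"

text \<open>The vertex \<open>v\<^sub>p\<close> and the edge \<open>e\<^sub>p\<close> are both represented by the path \<open>p\<close>;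
  \<open>butlast\<close> removes the last letter of \<open>p\<close>.\<close>

definition tree_rep ::
  "('v, 'e) pre_digraph \<Rightarrow> ('e \<Rightarrow> nat) \<Rightarrow> ('a, 'b, 'v, 'e) repgraph \<Rightarrow> 'a \<Rightarrow>
   (('v, 'e tedge dedge) path, ('v, 'e tedge dedge) path, 'v, 'e) repgraph" where
  "tree_rep E w F u = \<lparr>
     gr = \<lparr>verts = reduced_image E w F u,
           arcs = reduced_image E w F u - {(vmap F u, [])},
           tail = (\<lambda>(a, xs). case last xs of Fwd x \<Rightarrow> (a, butlast xs) | Rev x \<Rightarrow> (a, xs)),
           head = (\<lambda>(a, xs). case last xs of Fwd x \<Rightarrow> (a, xs) | Rev x \<Rightarrow> (a, butlast xs))\<rparr>,
     vmap = (\<lambda>(a, xs). pre_digraph.awlast (double (hat E w)) a xs),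
     amap = (\<lambda>(a, xs). case last xs of Fwd x \<Rightarrow> x | Rev x \<Rightarrow> x)\<rparr>"

end

theory Submission
  imports Defs
begin

text \<open>
  A representation graph is a deterministic automaton. Read an edge \<open>f\<close> as a transition labelled
  \<open>Fwd (amap F f)\<close> in its own direction and \<open>Rev (amap F f)\<close> backwards. The two defining
  conditions then say that no vertex has two transitions with the same label, and that the labels
  available at a vertex \<open>v\<close> over \<open>a\<close> contain each tag up to the weight of \<open>a\<close> exactly once among
  the \<open>Fwd\<close> labels and each edge of \<open>E\<close> into \<open>a\<close> exactly once among the \<open>Rev\<close> labels (\<open>representation_graph_iff\<close>).
  In this reading \<open>path_image F v\<close> is the set of words that can be read from \<open>v\<close>, and, \<open>F\<close> being
  deterministic, a word determines the vertex at which it ends.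

  The maps to use are the coverings: vertex maps that preserve transitions and do not enlarge the
  set of available labels. A covering preserves \<open>path_image\<close> (\<open>covering_path_image\<close>), and the
  property of being a representation graph passes through it, between deterministic graphs, from
  the target to the source and, if it is surjective, from the source to the target, because beyond
  determinism that property depends only on the local label sets and base points. Two families of coverings prove the theorem.

  First, an admissible relation identifies only vertices with the same readable words, so the
  projection onto a quotient is a covering (\<open>quotient_covering\<close>). Hence quotients of the tree \<open>T\<close>
  are connected representation graphs with the same path images as \<open>T\<close>, that is, they lie in the
  class \<open>C\<close>.

  Secondly, sending a reduced word to the vertex at which it ends is a covering from \<open>T\<close> to \<open>F\<close>
  (\<open>tree_covering\<close>). But \<open>T\<close> is built from the set \<open>path_image F u\<close> alone. Any \<open>G\<close> in the class
  has a vertex \<open>v\<close> with \<open>path_image G v = path_image F u\<close> (\<open>rep_equiv_transport\<close>), so the tree of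
  \<open>(G, v)\<close> is literally \<open>T\<close>, and \<open>T\<close> covers \<open>G\<close> as well. Connectedness of \<open>G\<close> makes the
  covering surjective, and \<open>G\<close> is isomorphic to the quotient of \<open>T\<close> by its fibres
  (\<open>covered_iso_quotient\<close>).

  Since a covering preserves \<open>path_image\<close>, its fibres are contained in the classes of \<open>sim T\<close>,
  and they are equal to them if no two vertices of \<open>G\<close> have the same path image. This identifies
  every irreducible \<open>G\<close> in the class with the quotient by \<open>sim T\<close>.
\<close>

section \<open>Representation graphs as deterministic labelled graphs\<close>

definition flip :: "'x dedge \<Rightarrow> 'x dedge" where
  "flip y = (case y of Fwd x \<Rightarrow> Rev x | Rev x \<Rightarrow> Fwd x)"

lemma flip_simps [simp]: "flip (Fwd x) = Rev x" "flip (Rev x) = Fwd x" "flip (flip y) = y"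
  by (auto simp: flip_def split: dedge.splits)

text \<open>One transition of the automaton: crossing an edge forwards or backwards, labelled by the
  image of that step in the double of the unfolded graph.\<close>

definition step :: "('a, 'b, 'v, 'e) repgraph \<Rightarrow> 'a \<Rightarrow> 'e tedge dedge \<Rightarrow> 'a \<Rightarrow> bool" where
  "step F v y v' \<longleftrightarrow> (\<exists>f\<in>arcs (gr F). case y of
      Fwd x \<Rightarrow> tail (gr F) f = v \<and> head (gr F) f = v' \<and> amap F f = x
    | Rev x \<Rightarrow> head (gr F) f = v \<and> tail (gr F) f = v' \<and> amap F f = x)"

text \<open>The relation \<open>run F v ys v'\<close> replaces a path of the double graph by the word of its labels.
  This is harmless because the path can be recovered from the word in a representation graph.\<close>

primrec run :: "('a, 'b, 'v, 'e) repgraph \<Rightarrow> 'a \<Rightarrow> 'e tedge dedge list \<Rightarrow> 'a \<Rightarrow> bool" where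
  "run F v [] v' \<longleftrightarrow> v \<in> verts (gr F) \<and> v' = v"
| "run F v (y # ys) v' \<longleftrightarrow> (\<exists>m. step F v y m \<and> run F m ys v')"

lemma step_Fwd:
  "step F v (Fwd x) v' \<longleftrightarrow>
     (\<exists>f\<in>arcs (gr F). tail (gr F) f = v \<and> head (gr F) f = v' \<and> amap F f = x)"
  and step_Rev:
  "step F v (Rev x) v' \<longleftrightarrow>
     (\<exists>f\<in>arcs (gr F). head (gr F) f = v \<and> tail (gr F) f = v' \<and> amap F f = x)"
  by (simp_all add: step_def)

lemma arc_step:
  assumes "f \<in> arcs (gr F)"
  shows "step F (tail (gr F) f) (Fwd (amap F f)) (head (gr F) f)"
  using assms by (auto simp: step_Fwd)

lemma step_flip: "step F v y v' \<Longrightarrow> step F v' (flip y) v"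
  by (cases y) (auto simp: step_Fwd step_Rev)

lemma step_verts:
  assumes "wf_digraph (gr F)" "step F v y v'"
  shows "v \<in> verts (gr F)" "v' \<in> verts (gr F)"
  using assms
  by (cases y; force simp: step_Fwd step_Rev wf_digraph.tail_in_verts wf_digraph.head_in_verts)+

lemma run_verts:
  assumes "wf_digraph (gr F)" "run F v ys v'"
  shows "v \<in> verts (gr F)" "v' \<in> verts (gr F)"
  using assms(2) by (induction ys arbitrary: v) (auto dest: step_verts[OF assms(1)])

lemma run_append:
  assumes "wf_digraph (gr F)"
  shows "run F v (xs @ ys) v' \<longleftrightarrow> (\<exists>m. run F v xs m \<and> run F m ys v')"
  by (induction xs arbitrary: v) (auto dest: run_verts[OF assms])

lemma run_single:
  assumes "wf_digraph (gr F)"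
  shows "run F v [y] v' \<longleftrightarrow> step F v y v'"
  by (auto dest: step_verts[OF assms])

lemma run_reverse:
  assumes "wf_digraph (gr F)" "run F v ys v'"
  shows "run F v' (rev (map flip ys)) v"
  using assms(2)
proof (induction ys arbitrary: v)
  case (Cons y ys)
  then obtain m where m: "step F v y m" "run F m ys v'" by auto
  then show ?case
    using Cons.IH[OF m(2)] step_flip[OF m(1)]
    by (auto simp: run_append[OF assms(1)] dest: step_verts[OF assms(1)])
qed auto

lemma wf_digraph_double: "wf_digraph G \<Longrightarrow> wf_digraph (double G)"
  by (unfold_locales)
    (auto simp: double_def wf_digraph.tail_in_verts wf_digraph.head_in_verts)

lemma step_iff_double_arc:
  "step F v y v' \<longleftrightarrow> (\<exists>d\<in>arcs (double (gr F)). tail (double (gr F)) d = v \<and>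
     head (double (gr F)) d = v' \<and> map_dedge (amap F) d = y)"
  by (cases y) (simp_all add: step_Fwd step_Rev double_def bex_Un conj_ac)

text \<open>The bridge to paths: runs are exactly the images of the walks in the double graph, so that
  path images, connectedness and admissibility can all be expressed by runs.\<close>

lemma run_iff_awalk:
  assumes "wf_digraph (gr F)"
  shows "run F v ys v' \<longleftrightarrow>
    (\<exists>ds. pre_digraph.awalk (double (gr F)) v ds v' \<and> map (map_dedge (amap F)) ds = ys)"
proof (induction ys arbitrary: v)
  case Nil
  then show ?case
    by (auto simp: pre_digraph.awalk_def pre_digraph.cas.simps double_def)
next
  case (Cons y ys)
  interpret D: wf_digraph "double (gr F)" by (rule wf_digraph_double[OF assms])
  have "(\<exists>ds. D.awalk v ds v' \<and> map (map_dedge (amap F)) ds = y # ys) \<longleftrightarrow>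
      (\<exists>d ds. D.awalk v (d # ds) v' \<and> map_dedge (amap F) d = y \<and>
         map (map_dedge (amap F)) ds = ys)"
    by (auto simp: map_eq_Cons_conv)
  also have "\<dots> \<longleftrightarrow> (\<exists>m. step F v y m \<and> run F m ys v')"
    unfolding Cons.IH step_iff_double_arc D.awalk_Cons_iff by auto
  finally show ?case by simp
qed

lemma mem_path_image_iff:
  assumes "wf_digraph (gr F)"
  shows "(a, ys) \<in> path_image F v \<longleftrightarrow> a = vmap F v \<and> (\<exists>v'. run F v ys v')"
proof -
  interpret D: wf_digraph "double (gr F)" by (rule wf_digraph_double[OF assms])
  show ?thesis
  proof
    assume "(a, ys) \<in> path_image F v"
    then obtain p v' where "D.awalk v p v'" "a = vmap F v" "ys = map (map_dedge (amap F)) p"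
      by (auto simp: path_image_def paths_from_def paths_between_def path_map_def)
    then show "a = vmap F v \<and> (\<exists>v'. run F v ys v')"
      unfolding run_iff_awalk[OF assms] by blast
  next
    assume "a = vmap F v \<and> (\<exists>v'. run F v ys v')"
    then obtain p v' where p: "D.awalk v p v'" "a = vmap F v" "ys = map (map_dedge (amap F)) p"
      unfolding run_iff_awalk[OF assms] by blast
    then have "(v, p) \<in> paths_from (double (gr F)) v"
      unfolding paths_from_def paths_between_def using D.awalk_last_in_verts[OF p(1)] by blast
    then have "path_map F (v, p) \<in> path_image F v" unfolding path_image_def by (rule imageI)
    then show "(a, ys) \<in> path_image F v" using p by (simp add: path_map_def)
  qed
qed

lemma path_image_eq_iff:
  assumes "wf_digraph (gr F)" "wf_digraph (gr G)" "v \<in> verts (gr F)"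
  shows "path_image F v = path_image G v' \<longleftrightarrow>
    vmap F v = vmap G v' \<and> (\<forall>ys. (\<exists>m. run F v ys m) \<longleftrightarrow> (\<exists>m. run G v' ys m))"
proof
  assume eq: "path_image F v = path_image G v'"
  have "(vmap F v, []) \<in> path_image G v'" using path_image_Nil[OF assms(3)] eq by simp
  then have "vmap F v = vmap G v'" by (simp add: mem_path_image_iff[OF assms(2)])
  then show "vmap F v = vmap G v' \<and> (\<forall>ys. (\<exists>m. run F v ys m) \<longleftrightarrow> (\<exists>m. run G v' ys m))"
    using eq mem_path_image_iff[OF assms(1)] mem_path_image_iff[OF assms(2)] by metis
qed (auto simp: set_eq_iff mem_path_image_iff[OF assms(1)] mem_path_image_iff[OF assms(2)])

lemma connected_graph_iff_run:
  assumes "wf_digraph (gr F)"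
  shows "connected_graph (gr F) \<longleftrightarrow> (\<forall>u\<in>verts (gr F). \<forall>v\<in>verts (gr F). \<exists>ys. run F u ys v)"
  unfolding connected_graph_def paths_between_def run_iff_awalk[OF assms] by auto

text \<open>Runs can be reversed, so it is enough to reach every vertex from one fixed vertex.\<close>

lemma connected_graphI:
  assumes "wf_digraph (gr F)" "\<And>v. v \<in> verts (gr F) \<Longrightarrow> \<exists>ys. run F r ys v"
  shows "connected_graph (gr F)"
  unfolding connected_graph_iff_run[OF assms(1)]
proof (intro ballI)
  fix u v assume "u \<in> verts (gr F)" "v \<in> verts (gr F)"
  then obtain xs ys where "run F r xs u" "run F r ys v" using assms(2) by blast
  then have "run F u (rev (map flip xs) @ ys) v"
    using run_reverse[OF assms(1)] unfolding run_append[OF assms(1)] by blast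
  then show "\<exists>ys. run F u ys v" by blast
qed

text \<open>Determinism, at the level of edges: a vertex has no two outgoing and no two incoming edges
  with the same label.\<close>

definition faithful :: "('a, 'b, 'v, 'e) repgraph \<Rightarrow> bool" where
  "faithful F \<longleftrightarrow> (\<forall>f\<in>arcs (gr F). \<forall>g\<in>arcs (gr F). amap F f = amap F g \<and>
     (tail (gr F) f = tail (gr F) g \<or> head (gr F) f = head (gr F) g) \<longrightarrow> f = g)"

lemma faithfulD:
  assumes "faithful F" "f \<in> arcs (gr F)" "g \<in> arcs (gr F)" "amap F f = amap F g"
    "tail (gr F) f = tail (gr F) g \<or> head (gr F) f = head (gr F) g"
  shows "f = g"
  using assms unfolding faithful_def by blast

lemma step_deterministic:
  assumes "faithful F" "step F v y a" "step F v y b"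
  shows "a = b"
proof (cases y)
  case (Fwd x)
  with assms(2,3) show ?thesis unfolding Fwd step_Fwd using faithfulD[OF assms(1)] by metis
next
  case (Rev x)
  with assms(2,3) show ?thesis unfolding Rev step_Rev using faithfulD[OF assms(1)] by metis
qed

lemma run_deterministic:
  assumes "faithful F" "run F v ys a" "run F v ys b"
  shows "a = b"
  using assms(2,3)
proof (induction ys arbitrary: v)
  case (Cons y ys)
  then obtain m n where "step F v y m" "run F m ys a" "step F v y n" "run F n ys b" by auto
  then show ?case using Cons.IH step_deterministic[OF assms(1)] by metis
qed auto

text \<open>The part of the definition of a representation graph that concerns a single vertex lying over
  \<open>a\<close>, as a property of the set \<open>L\<close> of labels that can be read there. Stated without
  reference to the edges, it can be carried along any map that preserves label sets.\<close>

definition complete_labels ::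
  "('v, 'e) pre_digraph \<Rightarrow> ('e \<Rightarrow> nat) \<Rightarrow> 'v \<Rightarrow> 'e tedge dedge set \<Rightarrow> bool" where
  "complete_labels E w a L \<longleftrightarrow>
     (\<forall>i. 1 \<le> i \<and> i \<le> vweight E w a \<longrightarrow> (\<exists>!e. Fwd (e, i) \<in> L)) \<and>
     (\<forall>e\<in>in_arcs E a. \<exists>!i. Rev (e, i) \<in> L)"

lemma weight_le_vweight:
  assumes "weighted_graph E w" "e \<in> arcs E"
  shows "w e \<le> vweight E w (tail E e)"
proof -
  interpret weighted_graph E w by (rule assms(1))
  have "e \<in> out_arcs E (tail E e)" using assms(2) by simp
  moreover have "finite (out_arcs E (tail E e))"
    using row_finite_E assms(2) by (simp add: row_finite_def)
  ultimately show ?thesis by (auto simp: vweight_def)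
qed

text \<open>An edge with a given tag is unique exactly when its label is unique among the labels with that
  tag and its label determines the edge; likewise for incoming edges. Row-finiteness comes for free,
  because labels separate the edges leaving a vertex and only finitely many labels can occur.\<close>

lemma representation_graph_iff:
  assumes "weighted_graph E w"
  shows "representation_graph E w F \<longleftrightarrow>
    wf_digraph (gr F) \<and> graph_hom (gr F) (hat E w) (vmap F) (amap F) \<and> faithful F \<and>
    (\<forall>v\<in>verts (gr F). complete_labels E w (vmap F v) {y. \<exists>v'. step F v y v'})"
    (is "?rep \<longleftrightarrow> ?wf \<and> ?hom \<and> ?faithful \<and> ?complete")
proof -
  have arcD: "amap F f \<in> arcs (hat E w)" "st (amap F f) \<in> arcs E"
      "1 \<le> tag (amap F f)" "tag (amap F f) \<le> vweight E w (vmap F (tail (gr F) f))"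
      "st (amap F f) \<in> out_arcs E (vmap F (tail (gr F) f))"
      "tag (amap F f) \<le> w (st (amap F f))"
      "st (amap F f) \<in> in_arcs E (vmap F (head (gr F) f))"
    if ?hom "f \<in> arcs (gr F)" for f
    using that weight_le_vweight[OF assms, of "st (amap F f)"]
    by (auto simp: graph_hom_def hat_def)
  show ?thesis
  proof
    assume rep: ?rep
    then have wf: ?wf and hom: ?hom
      and out: "\<And>v i. v \<in> verts (gr F) \<Longrightarrow> 1 \<le> i \<Longrightarrow> i \<le> vweight E w (vmap F v) \<Longrightarrow>
          \<exists>!f. f \<in> out_arcs (gr F) v \<and> tag (amap F f) = i"
      and inn: "\<And>v e. v \<in> verts (gr F) \<Longrightarrow> e \<in> in_arcs E (vmap F v) \<Longrightarrow>
          \<exists>!f. f \<in> in_arcs (gr F) v \<and> st (amap F f) = e"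
      unfolding representation_graph_def by blast+
    have ?faithful
      unfolding faithful_def
    proof (intro ballI impI, elim conjE disjE)
      fix f g assume f: "f \<in> arcs (gr F)" and g: "g \<in> arcs (gr F)" and eq: "amap F f = amap F g"
      show "f = g" if "tail (gr F) f = tail (gr F) g"
      proof -
        have "\<exists>!h. h \<in> out_arcs (gr F) (tail (gr F) f) \<and> tag (amap F h) = tag (amap F f)"
          by (rule out[OF wf_digraph.tail_in_verts[OF wf f] arcD(3,4)[OF hom f]])
        moreover have "f \<in> out_arcs (gr F) (tail (gr F) f)" "g \<in> out_arcs (gr F) (tail (gr F) f)"
          using f g that by auto
        ultimately show ?thesis using eq by metis
      qed
      show "f = g" if "head (gr F) f = head (gr F) g"
      proof -
        have "\<exists>!h. h \<in> in_arcs (gr F) (head (gr F) f) \<and> st (amap F h) = st (amap F f)"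
          by (rule inn[OF wf_digraph.head_in_verts[OF wf f] arcD(7)[OF hom f]])
        moreover have "f \<in> in_arcs (gr F) (head (gr F) f)" "g \<in> in_arcs (gr F) (head (gr F) f)"
          using f g that by auto
        ultimately show ?thesis using eq by metis
      qed
    qed
    moreover have ?complete
      unfolding complete_labels_def
    proof (intro ballI conjI allI impI)
      fix v i assume v: "v \<in> verts (gr F)" and i: "1 \<le> i \<and> i \<le> vweight E w (vmap F v)"
      obtain f where f: "f \<in> out_arcs (gr F) v" "tag (amap F f) = i"
        and uniq: "\<And>g. g \<in> out_arcs (gr F) v \<Longrightarrow> tag (amap F g) = i \<Longrightarrow> g = f"
        using out[OF v] i by blast
      show "\<exists>!e. Fwd (e, i) \<in> {y. \<exists>v'. step F v y v'}"
      proof (rule ex1I[of _ "st (amap F f)"])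
        show "Fwd (st (amap F f), i) \<in> {y. \<exists>v'. step F v y v'}"
          using f arc_step[of f F] by (cases "amap F f") auto
        show "e = st (amap F f)" if e: "Fwd (e, i) \<in> {y. \<exists>v'. step F v y v'}" for e
        proof -
          obtain g where "g \<in> out_arcs (gr F) v" "amap F g = (e, i)"
            using e by (auto simp: step_Fwd)
          then show ?thesis using uniq[of g] by simp
        qed
      qed
    next
      fix v e assume v: "v \<in> verts (gr F)" and e: "e \<in> in_arcs E (vmap F v)"
      obtain f where f: "f \<in> in_arcs (gr F) v" "st (amap F f) = e"
        and uniq: "\<And>g. g \<in> in_arcs (gr F) v \<Longrightarrow> st (amap F g) = e \<Longrightarrow> g = f"
        using inn[OF v e] by blast
      show "\<exists>!i. Rev (e, i) \<in> {y. \<exists>v'. step F v y v'}"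
      proof (rule ex1I[of _ "tag (amap F f)"])
        show "Rev (e, tag (amap F f)) \<in> {y. \<exists>v'. step F v y v'}"
          using f step_flip[OF arc_step[of f F]] by (cases "amap F f") auto
        show "i = tag (amap F f)" if i: "Rev (e, i) \<in> {y. \<exists>v'. step F v y v'}" for i
        proof -
          obtain g where "g \<in> in_arcs (gr F) v" "amap F g = (e, i)"
            using i by (auto simp: step_Rev)
          then show ?thesis using uniq[of g] by simp
        qed
      qed
    qed
    ultimately show "?wf \<and> ?hom \<and> ?faithful \<and> ?complete" using wf hom by blast
  next
    assume r: "?wf \<and> ?hom \<and> ?faithful \<and> ?complete"
    then have wf: ?wf and hom: ?hom and faithful: ?faithful by blast+
    have complete: "complete_labels E w (vmap F v) {y. \<exists>v'. step F v y v'}"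
      if "v \<in> verts (gr F)" for v
      using r that by blast
    have fin: "row_finite (gr F)"
      unfolding row_finite_def
    proof
      fix v assume "v \<in> verts (gr F)"
      let ?B = "Sigma (out_arcs E (vmap F v)) (\<lambda>e. {..w e})"
      have "vmap F v \<in> verts E"
        using hom \<open>v \<in> verts (gr F)\<close> by (auto simp: graph_hom_def hat_def)
      then have "finite ?B"
        using weighted_graph.row_finite_E[OF assms] by (auto simp: row_finite_def)
      moreover have "amap F ` out_arcs (gr F) v \<subseteq> ?B"
      proof (rule image_subsetI)
        fix f assume "f \<in> out_arcs (gr F) v"
        then show "amap F f \<in> ?B"
          using arcD(5,6)[OF hom, of f] by (cases "amap F f") auto
      qed
      moreover have "inj_on (amap F) (out_arcs (gr F) v)"
        by (rule inj_onI, rule faithfulD[OF faithful]) auto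
      ultimately show "finite (out_arcs (gr F) v)"
        by (meson finite_subset finite_imageD)
    qed
    have out: "\<exists>!f. f \<in> out_arcs (gr F) v \<and> tag (amap F f) = i"
      if v: "v \<in> verts (gr F)" and i: "1 \<le> i \<and> i \<le> vweight E w (vmap F v)" for v i
    proof -
      have "\<exists>!e. Fwd (e, i) \<in> {y. \<exists>v'. step F v y v'}"
        using complete[OF v] i unfolding complete_labels_def by blast
      then obtain e where e: "\<exists>v'. step F v (Fwd (e, i)) v'"
        and uniq: "\<And>e'. \<exists>v'. step F v (Fwd (e', i)) v' \<Longrightarrow> e' = e" by auto
      obtain f where f: "f \<in> out_arcs (gr F) v" "amap F f = (e, i)"
        using e by (auto simp: step_Fwd)
      show ?thesis
      proof (rule ex1I[of _ f])
        fix g assume g: "g \<in> out_arcs (gr F) v \<and> tag (amap F g) = i"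
        then have lab: "amap F g = (st (amap F g), i)" by (auto simp: prod_eq_iff)
        have "step F v (Fwd (st (amap F g), i)) (head (gr F) g)"
          using arc_step[of g F] g lab by (metis in_out_arcs_conv)
        then have "amap F g = (e, i)" using uniq lab by metis
        then show "g = f" using faithfulD[OF faithful, of g f] f g by simp
      qed (use f in auto)
    qed
    have inn: "\<exists>!f. f \<in> in_arcs (gr F) v \<and> st (amap F f) = e"
      if v: "v \<in> verts (gr F)" and e: "e \<in> in_arcs E (vmap F v)" for v e
    proof -
      have "\<exists>!i. Rev (e, i) \<in> {y. \<exists>v'. step F v y v'}"
        using complete[OF v] e unfolding complete_labels_def by blast
      then obtain i where i: "\<exists>v'. step F v (Rev (e, i)) v'"
        and uniq: "\<And>i'. \<exists>v'. step F v (Rev (e, i')) v' \<Longrightarrow> i' = i" by auto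
      obtain f where f: "f \<in> in_arcs (gr F) v" "amap F f = (e, i)"
        using i by (auto simp: step_Rev)
      show ?thesis
      proof (rule ex1I[of _ f])
        fix g assume g: "g \<in> in_arcs (gr F) v \<and> st (amap F g) = e"
        then have lab: "amap F g = (e, tag (amap F g))" by (auto simp: prod_eq_iff)
        have "step F v (Rev (e, tag (amap F g))) (tail (gr F) g)"
          using step_flip[OF arc_step[of g F]] g lab by (metis flip_simps(1) in_in_arcs_conv)
        then have "amap F g = (e, i)" using uniq lab by metis
        then show "g = f" using faithfulD[OF faithful, of g f] f g by simp
      qed (use f in auto)
    qed
    show ?rep unfolding representation_graph_def using wf hom fin out inn by blast
  qed
qed

lemma representation_graphD:
  assumes "weighted_graph E w" "representation_graph E w F"
  shows "wf_digraph (gr F)" "graph_hom (gr F) (hat E w) (vmap F) (amap F)" "faithful F"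
    and "v \<in> verts (gr F) \<Longrightarrow> complete_labels E w (vmap F v) {y. \<exists>v'. step F v y v'}"
  using assms(2) unfolding representation_graph_iff[OF assms(1)] by simp_all

section \<open>Coverings\<close>

text \<open>Only the vertex map is recorded: in a faithful target the image of an edge is determined by
  the image of its source and its label. Together with faithfulness of both graphs the last clause
  makes the map bijective on the edges at each vertex.\<close>

definition covering ::
  "('a, 'b, 'v, 'e) repgraph \<Rightarrow> ('c, 'd, 'v, 'e) repgraph \<Rightarrow> ('a \<Rightarrow> 'c) \<Rightarrow> bool" where
  "covering F G \<alpha> \<longleftrightarrow>
     (\<forall>v\<in>verts (gr F). \<alpha> v \<in> verts (gr G) \<and> vmap G (\<alpha> v) = vmap F v) \<and>
     (\<forall>v y v'. step F v y v' \<longrightarrow> step G (\<alpha> v) y (\<alpha> v')) \<and>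
     (\<forall>v\<in>verts (gr F). \<forall>y m. step G (\<alpha> v) y m \<longrightarrow> (\<exists>v'. step F v y v'))"

lemma coveringD:
  assumes "covering F G \<alpha>"
  shows "v \<in> verts (gr F) \<Longrightarrow> \<alpha> v \<in> verts (gr G)"
    and "v \<in> verts (gr F) \<Longrightarrow> vmap G (\<alpha> v) = vmap F v"
    and "step F v y v' \<Longrightarrow> step G (\<alpha> v) y (\<alpha> v')"
    and "v \<in> verts (gr F) \<Longrightarrow> step G (\<alpha> v) y m \<Longrightarrow> \<exists>v'. step F v y v'"
  using assms unfolding covering_def by blast+

lemma covering_labels:
  assumes "covering F G \<alpha>" "v \<in> verts (gr F)"
  shows "{y. \<exists>m. step G (\<alpha> v) y m} = {y. \<exists>v'. step F v y v'}"
  using assms unfolding covering_def by blast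

lemma covering_run:
  assumes "covering F G \<alpha>" "run F v ys v'"
  shows "run G (\<alpha> v) ys (\<alpha> v')"
  using assms(2)
proof (induction ys arbitrary: v)
  case Nil
  then show ?case using coveringD(1)[OF assms(1)] by auto
next
  case (Cons y ys)
  then obtain m where "step F v y m" "run F m ys v'" by auto
  then show ?case using Cons.IH coveringD(3)[OF assms(1)] by (simp only: run.simps) blast
qed

text \<open>Unique path lifting. A transition at \<open>\<alpha> v\<close> lifts to some transition at \<open>v\<close> with the same
  label, and determinism of the target forces the end of the lift to lie over the given end.\<close>

lemma covering_run_lift:
  assumes "covering F G \<alpha>" "wf_digraph (gr F)" "faithful G" "v \<in> verts (gr F)"
    "run G (\<alpha> v) ys m"
  shows "\<exists>v'. run F v ys v' \<and> \<alpha> v' = m"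
  using assms(4,5)
proof (induction ys arbitrary: v)
  case (Cons y ys)
  then obtain k where k: "step G (\<alpha> v) y k" "run G k ys m" by auto
  obtain v' where v': "step F v y v'" using coveringD(4)[OF assms(1) Cons.prems(1) k(1)] by blast
  then have "step G (\<alpha> v) y (\<alpha> v')" by (rule coveringD(3)[OF assms(1)])
  then have "\<alpha> v' = k" using step_deterministic[OF assms(3)] k(1) by blast
  then show ?case using Cons.IH[of v'] k(2) v' step_verts(2)[OF assms(2) v'] by auto
qed auto

lemma covering_path_image:
  assumes "covering F G \<alpha>" "wf_digraph (gr F)" "wf_digraph (gr G)" "faithful G" "v \<in> verts (gr F)"
  shows "path_image F v = path_image G (\<alpha> v)"
  unfolding path_image_eq_iff[OF assms(2,3,5)]
  using coveringD(2)[OF assms(1,5)] covering_run[OF assms(1)]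
    covering_run_lift[OF assms(1,2,4,5)] by metis

lemma representation_graph_of_covering:
  assumes "weighted_graph E w" "covering F G \<alpha>" "representation_graph E w G"
    "wf_digraph (gr F)" "faithful F"
  shows "representation_graph E w F"
proof -
  note G = representation_graphD[OF assms(1,3)] and cov = coveringD[OF assms(2)]
  have "graph_hom (gr F) (hat E w) (vmap F) (amap F)"
    unfolding graph_hom_def
  proof (intro conjI ballI)
    fix v assume "v \<in> verts (gr F)"
    then show "vmap F v \<in> verts (hat E w)"
      using G(2) cov(1)[of v] cov(2)[of v] by (simp add: graph_hom_def flip: cov(2))
  next
    fix f assume f: "f \<in> arcs (gr F)"
    have "step G (\<alpha> (tail (gr F) f)) (Fwd (amap F f)) (\<alpha> (head (gr F) f))"
      by (rule cov(3)[OF arc_step[OF f]])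
    then obtain g where g: "g \<in> arcs (gr G)" "tail (gr G) g = \<alpha> (tail (gr F) f)"
      "head (gr G) g = \<alpha> (head (gr F) f)" "amap G g = amap F f"
      by (auto simp: step_Fwd)
    have "vmap G (\<alpha> (tail (gr F) f)) = vmap F (tail (gr F) f)"
      "vmap G (\<alpha> (head (gr F) f)) = vmap F (head (gr F) f)"
      by (rule cov(2), use f assms(4) in
        \<open>simp add: wf_digraph.tail_in_verts wf_digraph.head_in_verts\<close>)+
    then show "amap F f \<in> arcs (hat E w)"
      "tail (hat E w) (amap F f) = vmap F (tail (gr F) f)"
      "head (hat E w) (amap F f) = vmap F (head (gr F) f)"
      using G(2) g unfolding graph_hom_def by metis+
  qed
  moreover have "complete_labels E w (vmap F v) {y. \<exists>v'. step F v y v'}"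
    if "v \<in> verts (gr F)" for v
    using G(4)[OF cov(1)[OF that]] unfolding covering_labels[OF assms(2) that] cov(2)[OF that] .
  ultimately show ?thesis unfolding representation_graph_iff[OF assms(1)] using assms(4,5) by blast
qed

lemma representation_graph_of_covered:
  assumes "weighted_graph E w" "covering F G \<alpha>" "\<alpha> ` verts (gr F) = verts (gr G)"
    "representation_graph E w F" "wf_digraph (gr G)" "faithful G"
  shows "representation_graph E w G"
proof -
  note F = representation_graphD[OF assms(1,4)] and cov = coveringD[OF assms(2)]
  have "graph_hom (gr G) (hat E w) (vmap G) (amap G)"
    unfolding graph_hom_def
  proof (intro conjI ballI)
    fix m assume "m \<in> verts (gr G)"
    then obtain a where "a \<in> verts (gr F)" "m = \<alpha> a" using assms(3) by auto
    then show "vmap G m \<in> verts (hat E w)" using F(2) cov(2) by (simp add: graph_hom_def)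
  next
    fix g assume g: "g \<in> arcs (gr G)"
    then obtain a where a: "a \<in> verts (gr F)" "tail (gr G) g = \<alpha> a"
      using assms(3) wf_digraph.tail_in_verts[OF assms(5) g] by (metis imageE)
    have sg: "step G (\<alpha> a) (Fwd (amap G g)) (head (gr G) g)" using arc_step[OF g] a(2) by simp
    then obtain b where b: "step F a (Fwd (amap G g)) b" using cov(4)[OF a(1)] by blast
    have hd: "head (gr G) g = \<alpha> b" by (rule step_deterministic[OF assms(6) sg cov(3)[OF b]])
    obtain f where f: "f \<in> arcs (gr F)" "tail (gr F) f = a" "head (gr F) f = b" "amap F f = amap G g"
      using b by (auto simp: step_Fwd)
    have "vmap G (tail (gr G) g) = vmap F (tail (gr F) f)"
      "vmap G (head (gr G) g) = vmap F (head (gr F) f)"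
      using a hd f cov(2) step_verts[OF F(1) b] by simp_all
    then show "amap G g \<in> arcs (hat E w)"
      "tail (hat E w) (amap G g) = vmap G (tail (gr G) g)"
      "head (hat E w) (amap G g) = vmap G (head (gr G) g)"
      using F(2) f unfolding graph_hom_def by metis+
  qed
  moreover have "complete_labels E w (vmap G m) {y. \<exists>m'. step G m y m'}"
    if "m \<in> verts (gr G)" for m
  proof -
    from that obtain a where a: "a \<in> verts (gr F)" "m = \<alpha> a" using assms(3) by auto
    show ?thesis
      using F(4)[OF a(1)] unfolding a(2) covering_labels[OF assms(2) a(1)] cov(2)[OF a(1)] .
  qed
  ultimately show ?thesis unfolding representation_graph_iff[OF assms(1)] using assms(5,6) by blast
qed

lemma connected_covered:
  assumes "covering F G \<alpha>" "\<alpha> ` verts (gr F) = verts (gr G)" "wf_digraph (gr F)"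
    "wf_digraph (gr G)" "connected_graph (gr F)"
  shows "connected_graph (gr G)"
  unfolding connected_graph_iff_run[OF assms(4)] assms(2)[symmetric]
  using assms(5) covering_run[OF assms(1)]
  unfolding connected_graph_iff_run[OF assms(3)] by blast

text \<open>Lift a run from \<open>\<alpha> v\<close> to an arbitrary vertex of the connected target.\<close>

lemma covering_surj:
  assumes "covering F G \<alpha>" "wf_digraph (gr F)" "wf_digraph (gr G)" "faithful G"
    "v \<in> verts (gr F)" "connected_graph (gr G)"
  shows "\<alpha> ` verts (gr F) = verts (gr G)"
proof
  show "\<alpha> ` verts (gr F) \<subseteq> verts (gr G)" using assms(1) by (auto simp: covering_def)
  show "verts (gr G) \<subseteq> \<alpha> ` verts (gr F)"
  proof
    fix m assume "m \<in> verts (gr G)"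
    moreover have "\<alpha> v \<in> verts (gr G)" using assms(1,5) by (auto simp: covering_def)
    ultimately obtain ys where "run G (\<alpha> v) ys m"
      using assms(6) by (auto simp: connected_graph_iff_run[OF assms(3)])
    then obtain v' where "run F v ys v'" "\<alpha> v' = m"
      using covering_run_lift[OF assms(1,2,4,5)] by blast
    then show "m \<in> \<alpha> ` verts (gr F)" using run_verts(2)[OF assms(2)] by blast
  qed
qed

section \<open>Isomorphisms\<close>

lemma rep_morphism_of_vertex_map:
  assumes "faithful G"
    and vert: "\<And>v. v \<in> verts (gr F) \<Longrightarrow> \<alpha> v \<in> verts (gr G) \<and> vmap G (\<alpha> v) = vmap F v"
    and step: "\<And>v y v'. step F v y v' \<Longrightarrow> step G (\<alpha> v) y (\<alpha> v')"
  obtains \<alpha>1 where "rep_morphism F G \<alpha> \<alpha>1"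
proof -
  have "\<exists>g. g \<in> arcs (gr G) \<and> tail (gr G) g = \<alpha> (tail (gr F) f) \<and>
      head (gr G) g = \<alpha> (head (gr F) f) \<and> amap G g = amap F f" if "f \<in> arcs (gr F)" for f
    using step[OF arc_step[OF that]] by (auto simp: step_Fwd)
  then obtain \<alpha>1 where "\<forall>f\<in>arcs (gr F). \<alpha>1 f \<in> arcs (gr G) \<and> tail (gr G) (\<alpha>1 f) = \<alpha> (tail (gr F) f) \<and>
      head (gr G) (\<alpha>1 f) = \<alpha> (head (gr F) f) \<and> amap G (\<alpha>1 f) = amap F f"
    by metis
  then have "rep_morphism F G \<alpha> \<alpha>1"
    using vert unfolding rep_morphism_def graph_hom_def by auto
  then show thesis by (rule that)
qed

text \<open>In a faithful graph an endomorphism that fixes the vertices and preserves the labels fixes the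
  edges.\<close>

lemma rep_morphism_round_trip:
  assumes "faithful F" "wf_digraph (gr F)" "rep_morphism F G \<alpha>0 \<alpha>1" "rep_morphism G F \<beta>0 \<beta>1"
    "\<forall>v\<in>verts (gr F). \<beta>0 (\<alpha>0 v) = v"
  shows "\<forall>f\<in>arcs (gr F). \<beta>1 (\<alpha>1 f) = f"
proof
  fix f assume f: "f \<in> arcs (gr F)"
  have "\<beta>1 (\<alpha>1 f) \<in> arcs (gr F) \<and> amap F (\<beta>1 (\<alpha>1 f)) = amap F f \<and>
      tail (gr F) (\<beta>1 (\<alpha>1 f)) = \<beta>0 (\<alpha>0 (tail (gr F) f))"
    using assms(3,4) f unfolding rep_morphism_def graph_hom_def by auto
  then show "\<beta>1 (\<alpha>1 f) = f"
    using assms(1,5) f wf_digraph.tail_in_verts[OF assms(2) f] unfolding faithful_def by metis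
qed

text \<open>Isomorphisms need not mention edges: the edge maps in both directions, and the fact that they
  are mutually inverse, come from determinism.\<close>

lemma rep_iso_of_vertex_bijection:
  assumes "faithful F" "faithful G" "wf_digraph (gr F)" "wf_digraph (gr G)"
    and bij: "bij_betw \<alpha> (verts (gr F)) (verts (gr G))"
    and vmap: "\<And>v. v \<in> verts (gr F) \<Longrightarrow> vmap G (\<alpha> v) = vmap F v"
    and step: "\<And>v y v'. v \<in> verts (gr F) \<Longrightarrow> v' \<in> verts (gr F) \<Longrightarrow>
      step F v y v' \<longleftrightarrow> step G (\<alpha> v) y (\<alpha> v')"
  shows "rep_iso F G"
proof -
  let ?\<beta> = "inv_into (verts (gr F)) \<alpha>"
  have \<beta>: "?\<beta> (\<alpha> v) = v" if "v \<in> verts (gr F)" for v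
    using bij that by (simp add: bij_betw_inv_into_left)
  have \<beta>': "\<alpha> (?\<beta> v) = v" "?\<beta> v \<in> verts (gr F)" if "v \<in> verts (gr G)" for v
    using bij that by (auto simp: bij_betw_inv_into_right bij_betw_imp_surj_on inv_into_into)
  obtain \<alpha>1 where \<alpha>1: "rep_morphism F G \<alpha> \<alpha>1"
  proof (rule rep_morphism_of_vertex_map[OF assms(2)])
    show "\<alpha> v \<in> verts (gr G) \<and> vmap G (\<alpha> v) = vmap F v" if "v \<in> verts (gr F)" for v
      using that vmap bij by (auto simp: bij_betw_def)
    show "step G (\<alpha> v) y (\<alpha> v')" if "step F v y v'" for v y v'
      using that step step_verts[OF assms(3) that] by blast
  qed
  obtain \<beta>1 where \<beta>1: "rep_morphism G F ?\<beta> \<beta>1"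
  proof (rule rep_morphism_of_vertex_map[OF assms(1)])
    show "?\<beta> v \<in> verts (gr F) \<and> vmap F (?\<beta> v) = vmap G v" if "v \<in> verts (gr G)" for v
      using \<beta>'[OF that] vmap by metis
    show "step F (?\<beta> v) y (?\<beta> v')" if "step G v y v'" for v y v'
      using that step \<beta>' step_verts[OF assms(4) that] by simp
  qed
  show ?thesis
    unfolding rep_iso_def
    using \<alpha>1 \<beta>1 \<beta> \<beta>' rep_morphism_round_trip[OF assms(1,3) \<alpha>1 \<beta>1]
      rep_morphism_round_trip[OF assms(2,4) \<beta>1 \<alpha>1] by blast
qed

section \<open>Quotients\<close>

text \<open>By determinism the words readable from \<open>u'\<close> are the words \<open>ys\<close> such that \<open>y # ys\<close> is
  readable from \<open>u\<close>; so they depend only on \<open>path_image F u\<close> and on \<open>y\<close>. The initial vertex of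
  the new words is the end of \<open>y\<close> in the double of the unfolded graph.\<close>

lemma path_image_residual:
  assumes "wf_digraph (gr F)" "faithful F" "wf_digraph (gr G)" "faithful G"
    "graph_hom (gr F) (hat E w) (vmap F) (amap F)" "graph_hom (gr G) (hat E w) (vmap G) (amap G)"
    "path_image F u = path_image G v" "step F u y u'" "step G v y v'"
  shows "path_image F u' = path_image G v'"
proof -
  note verts = step_verts[OF assms(1,8)] step_verts[OF assms(3,9)]
  have "(\<exists>m. run F u' ys m) \<longleftrightarrow> (\<exists>m. run G v' ys m)" for ys
  proof -
    have "(\<exists>m. run F u' ys m) \<longleftrightarrow> (\<exists>m. run F u (y # ys) m)"
      unfolding run.simps using assms(8) step_deterministic[OF assms(2) assms(8)] by blast
    also have "\<dots> \<longleftrightarrow> (\<exists>m. run G v (y # ys) m)"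
      using assms(7) unfolding path_image_eq_iff[OF assms(1,3) verts(1)] by blast
    also have "\<dots> \<longleftrightarrow> (\<exists>m. run G v' ys m)"
      unfolding run.simps using assms(9) step_deterministic[OF assms(4) assms(9)] by blast
    finally show ?thesis .
  qed
  moreover have "vmap F u' = vmap G v'"
  proof (cases y)
    case (Fwd x)
    obtain f where "f \<in> arcs (gr F)" "head (gr F) f = u'" "amap F f = x"
      using assms(8) by (auto simp: Fwd step_Fwd)
    moreover obtain g where "g \<in> arcs (gr G)" "head (gr G) g = v'" "amap G g = x"
      using assms(9) by (auto simp: Fwd step_Fwd)
    ultimately show ?thesis using assms(5,6) unfolding graph_hom_def by metis
  next
    case (Rev x)
    obtain f where "f \<in> arcs (gr F)" "tail (gr F) f = u'" "amap F f = x"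
      using assms(8) by (auto simp: Rev step_Rev)
    moreover obtain g where "g \<in> arcs (gr G)" "tail (gr G) g = v'" "amap G g = x"
      using assms(9) by (auto simp: Rev step_Rev)
    ultimately show ?thesis using assms(5,6) unfolding graph_hom_def by metis
  qed
  ultimately show ?thesis unfolding path_image_eq_iff[OF assms(1,3) verts(2)] by blast
qed

lemma sim_labels:
  assumes "wf_digraph (gr F)" "(u, v) \<in> sim F" "step F u y u'"
  shows "\<exists>v'. step F v y v'"
proof -
  have "path_image F u = path_image F v" "u \<in> verts (gr F)" using assms(2) by (auto simp: sim_def)
  then have "(\<exists>m. run F u [y] m) \<longleftrightarrow> (\<exists>m. run F v [y] m)"
    using path_image_eq_iff[OF assms(1,1)] by blast
  then show ?thesis using assms(3) unfolding run_single[OF assms(1)] by blast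
qed

lemma admissible_step:
  assumes "wf_digraph (gr F)" "admissible F R" "(u, v) \<in> R" "step F u y u'" "step F v y v'"
  shows "(u', v') \<in> R"
proof -
  obtain p where p: "pre_digraph.awalk (double (gr F)) u p u'" "map (map_dedge (amap F)) p = [y]"
    using assms(4) run_single[OF assms(1)] run_iff_awalk[OF assms(1)] by metis
  obtain q where q: "pre_digraph.awalk (double (gr F)) v q v'" "map (map_dedge (amap F)) q = [y]"
    using assms(5) run_single[OF assms(1)] run_iff_awalk[OF assms(1)] by metis
  have "(u, p) \<in> paths_between (double (gr F)) u u'" "(v, q) \<in> paths_between (double (gr F)) v v'"
    using p q by (auto simp: paths_between_def)
  moreover have "path_map F (u, p) = path_map F (v, q)"
    using p q sim_vmap[OF admissible_sim[OF assms(2,3)]] by (simp add: path_map_def)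
  ultimately show ?thesis using assms(2,3) unfolding admissible_def by meson
qed

text \<open>Condition (2) of admissibility speaks of arbitrarily long paths; by induction along a word it
  follows from the case of one transition.\<close>

lemma admissibleI:
  assumes "wf_digraph (gr F)" "equiv (verts (gr F)) R" "R \<subseteq> sim F"
    and step: "\<And>u v y u' v'. (u, v) \<in> R \<Longrightarrow> step F u y u' \<Longrightarrow> step F v y v' \<Longrightarrow> (u', v') \<in> R"
  shows "admissible F R"
proof -
  have run: "(x, y) \<in> R" if "(u, v) \<in> R" "run F u ys x" "run F v ys y" for u v ys x y
    using that
  proof (induction ys arbitrary: u v)
    case (Cons l ys)
    then obtain u' v' where "step F u l u'" "run F u' ys x" "step F v l v'" "run F v' ys y" by auto
    then show ?case using Cons.IH step[OF Cons.prems(1)] by blast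
  qed auto
  have "(x, y) \<in> R"
    if "p \<in> paths_between (double (gr F)) u x" "q \<in> paths_between (double (gr F)) v y"
      "(u, v) \<in> R" "path_map F p = path_map F q" for u v x y p q
  proof (rule run[OF that(3)])
    show "run F u (map (map_dedge (amap F)) (snd p)) x"
      using that(1) run_iff_awalk[OF assms(1)] by (auto simp: paths_between_def)
    show "run F v (map (map_dedge (amap F)) (snd p)) y"
    proof -
      have "map (map_dedge (amap F)) (snd p) = map (map_dedge (amap F)) (snd q)"
        using that(4) by (cases p; cases q) (simp add: path_map_def)
      then show ?thesis
        using that(2) run_iff_awalk[OF assms(1)] by (auto simp: paths_between_def)
    qed
  qed
  then show ?thesis unfolding admissible_def using assms(2,3) by blast
qed

lemma sim_admissible:
  assumes "weighted_graph E w" "representation_graph E w F"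
  shows "admissible F (sim F)"
proof -
  note F = representation_graphD[OF assms]
  show ?thesis
  proof (rule admissibleI)
    show "wf_digraph (gr F)" by (rule F(1))
    show "equiv (verts (gr F)) (sim F)"
      by (rule equivI) (auto simp: sim_def refl_on_def sym_def trans_def)
    show "(u', v') \<in> sim F" if "(u, v) \<in> sim F" "step F u y u'" "step F v y v'" for u v y u' v'
    proof -
      have "path_image F u = path_image F v" using that(1) by (simp add: sim_def)
      then have "path_image F u' = path_image F v'"
        by (rule path_image_residual[OF F(1,3) F(1,3) F(2) F(2) _ that(2,3)])
      then show ?thesis
        using step_verts(2)[OF F(1) that(2)] step_verts(2)[OF F(1) that(3)] by (simp add: sim_def)
    qed
  qed simp
qed

lemma verts_quotient: "verts (gr (quotient_rep F R)) = (\<lambda>v. R `` {v}) ` verts (gr F)"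
  and arcs_quotient: "arcs (gr (quotient_rep F R)) = (\<lambda>f. arc_rel F R `` {f}) ` arcs (gr F)"
  by (auto simp: quotient_rep_def quotient_def)

lemma quotient_step_iff:
  assumes "wf_digraph (gr F)" "admissible F R"
  shows "step (quotient_rep F R) A y B \<longleftrightarrow>
    (\<exists>v v'. A = R `` {v} \<and> B = R `` {v'} \<and> step F v y v')"
proof -
  note eq = admissible_equiv[OF assms(2)]
  note simps = quotient_rep_tail[OF eq _ assms(1)] quotient_rep_head[OF assms(2) _ assms(1)]
    quotient_rep_amap[OF eq _ assms(1)]
  show ?thesis
  proof (cases y)
    case (Fwd x)
    have "step (quotient_rep F R) A (Fwd x) B \<longleftrightarrow> (\<exists>f\<in>arcs (gr F).
        R `` {tail (gr F) f} = A \<and> R `` {head (gr F) f} = B \<and> amap F f = x)"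
      unfolding step_Fwd arcs_quotient by (simp add: simps cong: bex_cong_simp)
    then show ?thesis unfolding Fwd step_Fwd by blast
  next
    case (Rev x)
    have "step (quotient_rep F R) A (Rev x) B \<longleftrightarrow> (\<exists>f\<in>arcs (gr F).
        R `` {head (gr F) f} = A \<and> R `` {tail (gr F) f} = B \<and> amap F f = x)"
      unfolding step_Rev arcs_quotient by (simp add: simps cong: bex_cong_simp)
    then show ?thesis unfolding Rev step_Rev by blast
  qed
qed

text \<open>Two edge classes with the same label and the same target class also have the same source class:
  read the edges backwards and use that admissible relations respect transitions.\<close>

lemma quotient_wf_faithful:
  assumes "wf_digraph (gr F)" "faithful F" "admissible F R"
  shows "wf_digraph (gr (quotient_rep F R))" "faithful (quotient_rep F R)"
proof -
  note eq = admissible_equiv[OF assms(3)]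
  note simps = quotient_rep_tail[OF eq _ assms(1)] quotient_rep_head[OF assms(3) _ assms(1)]
    quotient_rep_amap[OF eq _ assms(1)]
  note ends = wf_digraph.tail_in_verts[OF assms(1)] wf_digraph.head_in_verts[OF assms(1)]
  show "wf_digraph (gr (quotient_rep F R))"
  proof (rule wf_digraph.intro)
    fix X assume "X \<in> arcs (gr (quotient_rep F R))"
    then obtain f where "f \<in> arcs (gr F)" "X = arc_rel F R `` {f}" unfolding arcs_quotient by blast
    then show "tail (gr (quotient_rep F R)) X \<in> verts (gr (quotient_rep F R))"
      "head (gr (quotient_rep F R)) X \<in> verts (gr (quotient_rep F R))"
      unfolding verts_quotient using ends by (simp_all add: simps)
  qed
  show "faithful (quotient_rep F R)"
    unfolding faithful_def
  proof (intro ballI impI)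
    fix X Y assume "X \<in> arcs (gr (quotient_rep F R))" "Y \<in> arcs (gr (quotient_rep F R))"
      and XY: "amap (quotient_rep F R) X = amap (quotient_rep F R) Y \<and>
        (tail (gr (quotient_rep F R)) X = tail (gr (quotient_rep F R)) Y \<or>
         head (gr (quotient_rep F R)) X = head (gr (quotient_rep F R)) Y)"
    then obtain f g where f: "f \<in> arcs (gr F)" "X = arc_rel F R `` {f}"
      and g: "g \<in> arcs (gr F)" "Y = arc_rel F R `` {g}"
      unfolding arcs_quotient by blast
    have lab: "amap F f = amap F g" using XY f g by (simp add: simps)
    have "R `` {tail (gr F) f} = R `` {tail (gr F) g} \<or> R `` {head (gr F) f} = R `` {head (gr F) g}"
      using XY f g by (simp add: simps)
    then have "(tail (gr F) f, tail (gr F) g) \<in> R \<or> (head (gr F) f, head (gr F) g) \<in> R"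
      using eq_equiv_class[OF _ eq] ends g(1) by blast
    then have tails: "(tail (gr F) f, tail (gr F) g) \<in> R"
    proof
      assume "(head (gr F) f, head (gr F) g) \<in> R"
      then show ?thesis
        using admissible_step[OF assms(1,3) _ step_flip[OF arc_step[OF f(1)]]]
          step_flip[OF arc_step[OF g(1)]] lab by metis
    qed
    have "arc_rel F R `` {f} = arc_rel F R `` {g}"
      unfolding arc_rel_def using f(1) g(1) lab equiv_class_eq[OF eq tails] by auto
    then show "X = Y" using f g by simp
  qed
qed

text \<open>No labels are gained at \<open>[v]\<close>: a transition there starts at some representative, and all
  representatives have the same readable words, in particular the same words of length one.\<close>

lemma quotient_covering:
  assumes "wf_digraph (gr F)" "admissible F R"
  shows "covering F (quotient_rep F R) (\<lambda>v. R `` {v})"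
  unfolding covering_def
proof (intro conjI ballI allI impI)
  note eq = admissible_equiv[OF assms(2)]
  show "R `` {v} \<in> verts (gr (quotient_rep F R))" if "v \<in> verts (gr F)" for v
    using that by (auto simp: verts_quotient)
  show "vmap (quotient_rep F R) (R `` {v}) = vmap F v" if "v \<in> verts (gr F)" for v
    by (rule quotient_rep_vmap[OF assms(2) that])
  show "step (quotient_rep F R) (R `` {v}) y (R `` {v'})" if "step F v y v'" for v y v'
    using that unfolding quotient_step_iff[OF assms] by blast
  show "\<exists>v'. step F v y v'" if v: "v \<in> verts (gr F)" and s: "step (quotient_rep F R) (R `` {v}) y m" for v y m
  proof -
    obtain a a' where a: "R `` {v} = R `` {a}" "step F a y a'"
      using s unfolding quotient_step_iff[OF assms] by blast
    have "(a, v) \<in> R" using eq_equiv_class[OF a(1)[symmetric] eq v] .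
    then show ?thesis using sim_labels[OF assms(1) admissible_sim[OF assms(2)] a(2)] by blast
  qed
qed

definition fibre_rel :: "('a, 'b, 'v, 'e) repgraph \<Rightarrow> ('a \<Rightarrow> 'c) \<Rightarrow> 'a rel" where
  "fibre_rel F \<alpha> = {(u, v). u \<in> verts (gr F) \<and> v \<in> verts (gr F) \<and> \<alpha> u = \<alpha> v}"

lemma fibre_rel_admissible:
  assumes "covering F G \<alpha>" "wf_digraph (gr F)" "wf_digraph (gr G)" "faithful G"
  shows "admissible F (fibre_rel F \<alpha>)"
proof (rule admissibleI[OF assms(2)])
  show "equiv (verts (gr F)) (fibre_rel F \<alpha>)"
    by (rule equivI) (auto simp: fibre_rel_def refl_on_def sym_def trans_def)
  show "fibre_rel F \<alpha> \<subseteq> sim F"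
    unfolding fibre_rel_def sim_def using covering_path_image[OF assms] by fastforce
  show "(u', v') \<in> fibre_rel F \<alpha>"
    if "(u, v) \<in> fibre_rel F \<alpha>" "step F u y u'" "step F v y v'" for u v y u' v'
  proof -
    have "step G (\<alpha> u) y (\<alpha> u')" "step G (\<alpha> v) y (\<alpha> v')"
      using that coveringD(3)[OF assms(1)] by blast+
    moreover have "\<alpha> u = \<alpha> v" using that(1) by (simp add: fibre_rel_def)
    ultimately have "\<alpha> u' = \<alpha> v'" using step_deterministic[OF assms(4)] by metis
    then show ?thesis
      using step_verts(2)[OF assms(2) that(2)] step_verts(2)[OF assms(2) that(3)]
      by (simp add: fibre_rel_def)
  qed
qed

text \<open>The first isomorphism theorem for coverings. The isomorphism sends a vertex of \<open>G\<close> to its fibre,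
  which is a class of \<open>fibre_rel F \<alpha>\<close>.\<close>

lemma covered_iso_quotient:
  assumes "covering F G \<alpha>" "wf_digraph (gr F)" "faithful F" "wf_digraph (gr G)" "faithful G"
    "\<alpha> ` verts (gr F) = verts (gr G)"
  shows "rep_iso G (quotient_rep F (fibre_rel F \<alpha>))"
proof -
  let ?R = "fibre_rel F \<alpha>"
  define \<gamma> where "\<gamma> m = {v \<in> verts (gr F). \<alpha> v = m}" for m
  note adm = fibre_rel_admissible[OF assms(1,2,4,5)] and cov = coveringD[OF assms(1)]
  have fibre: "?R `` {v} = \<gamma> (\<alpha> v)" if "v \<in> verts (gr F)" for v
    using that by (auto simp: fibre_rel_def \<gamma>_def)
  have lift: "\<exists>v\<in>verts (gr F). m = \<alpha> v" if "m \<in> verts (gr G)" for m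
    using that unfolding assms(6)[symmetric] by blast
  have inj: "m = n" if "m \<in> verts (gr G)" "\<gamma> m = \<gamma> n" for m n
    using lift[OF that(1)] that(2) unfolding \<gamma>_def by blast
  show ?thesis
  proof (rule rep_iso_of_vertex_bijection)
    show "bij_betw \<gamma> (verts (gr G)) (verts (gr (quotient_rep F ?R)))"
      unfolding bij_betw_def verts_quotient
    proof
      show "inj_on \<gamma> (verts (gr G))" by (rule inj_onI) (rule inj)
      show "\<gamma> ` verts (gr G) = (\<lambda>v. ?R `` {v}) ` verts (gr F)"
        unfolding assms(6)[symmetric] image_image by (intro image_cong) (simp_all add: fibre)
    qed
    show "vmap (quotient_rep F ?R) (\<gamma> m) = vmap G m" if m: "m \<in> verts (gr G)" for m
    proof -
      obtain v where v: "v \<in> verts (gr F)" "m = \<alpha> v" using lift[OF m] by blast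
      then show ?thesis using quotient_rep_vmap[OF adm v(1)] fibre[OF v(1)] cov(2)[OF v(1)] by simp
    qed
    show "step G m y m' \<longleftrightarrow> step (quotient_rep F ?R) (\<gamma> m) y (\<gamma> m')"
      if m: "m \<in> verts (gr G)" "m' \<in> verts (gr G)" for m y m'
    proof
      assume s: "step G m y m'"
      obtain v where v: "v \<in> verts (gr F)" "m = \<alpha> v" using lift[OF m(1)] by blast
      then obtain v' where v': "step F v y v'" using s cov(4) by blast
      have "m' = \<alpha> v'" using step_deterministic[OF assms(5) s] cov(3)[OF v'] v(2) by simp
      then show "step (quotient_rep F ?R) (\<gamma> m) y (\<gamma> m')"
        unfolding quotient_step_iff[OF assms(2) adm]
        using v v' fibre[OF v(1)] fibre[OF step_verts(2)[OF assms(2) v']] by auto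
    next
      assume "step (quotient_rep F ?R) (\<gamma> m) y (\<gamma> m')"
      then obtain v v' where v: "\<gamma> m = ?R `` {v}" "\<gamma> m' = ?R `` {v'}" "step F v y v'"
        unfolding quotient_step_iff[OF assms(2) adm] by blast
      have "m = \<alpha> v" "m' = \<alpha> v'"
        using v(1,2) fibre step_verts[OF assms(2) v(3)] inj[OF m(1)] inj[OF m(2)] by simp_all
      then show "step G m y m'" using cov(3)[OF v(3)] by simp
    qed
  qed (use assms quotient_wf_faithful[OF assms(2,3) adm] in simp_all)
qed

section \<open>The tree of reduced paths\<close>

text \<open>The letters are required to come from \<open>G\<close> because \<open>reduced\<close> only forbids backtracking along
  edges of \<open>G\<close>.\<close>

lemma reduced_snoc_iff:
  assumes "\<And>y. y \<in> set xs \<Longrightarrow> y \<in> Fwd ` arcs G \<union> Rev ` arcs G"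
  shows "reduced G (a, xs @ [y]) \<longleftrightarrow> reduced G (a, xs) \<and> \<not> (xs \<noteq> [] \<and> last xs = flip y)"
proof (cases xs rule: rev_cases)
  case Nil
  then show ?thesis by (auto simp: reduced_def Cons_eq_append_conv)
next
  case (snoc zs z)
  \<comment> \<open>A factor of length two either lies inside \<open>zs @ [z]\<close> or consists of the last two letters.\<close>
  have split: "zs @ [z] @ [y] = us @ [p, q] @ vs \<longleftrightarrow>
      (vs = [] \<and> us = zs \<and> p = z \<and> q = y) \<or> (\<exists>vs'. vs = vs' @ [y] \<and> zs @ [z] = us @ [p, q] @ vs')"
    for us vs p q
    by (cases vs rule: rev_cases) auto
  have z: "z \<in> Fwd ` arcs G \<union> Rev ` arcs G" using assms[of z] snoc by simp
  show ?thesis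
    unfolding reduced_def snd_conv snoc append.assoc split
    using z by (cases y; cases z) (auto; blast)+
qed

text \<open>The point on which the classification rests: the tree remembers nothing of the graph it was
  built from except the set of words readable from the base vertex.\<close>

lemma tree_rep_cong:
  assumes "wf_digraph (gr F)" "wf_digraph (gr G)" "u \<in> verts (gr F)"
    "path_image F u = path_image G v"
  shows "tree_rep E w F u = tree_rep E w G v"
proof -
  have "vmap F u = vmap G v" using assms(4) path_image_eq_iff[OF assms(1-3)] by simp
  moreover have "reduced_image E w F u = reduced_image E w G v"
    by (simp add: reduced_image_def assms(4))
  ultimately show ?thesis by (simp add: tree_rep_def)
qed

text \<open>The covering map from the tree to \<open>F\<close>: follow the word \<open>p\<close> from the base vertex \<open>u\<close>. The
  end is unique by determinism; nothing is claimed for words that cannot be read from \<open>u\<close>.\<close>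

definition endpoint :: "('a, 'b, 'v, 'e) repgraph \<Rightarrow> 'a \<Rightarrow> ('v, 'e tedge dedge) path \<Rightarrow> 'a" where
  "endpoint F u p = (THE v. run F u (snd p) v)"

lemma endpoint_eq:
  assumes "faithful F" "run F u xs v"
  shows "endpoint F u (a, xs) = v"
  unfolding endpoint_def snd_conv
  by (rule the_equality, rule assms(2)) (rule run_deterministic[OF assms(1) _ assms(2)])

lemma step_hom:
  assumes "graph_hom (gr F) (hat E w) (vmap F) (amap F)" "step F v y v'"
  shows "y \<in> arcs (double (hat E w)) \<and> head (double (hat E w)) y = vmap F v'"
proof (cases y)
  case (Fwd x)
  obtain f where "f \<in> arcs (gr F)" "head (gr F) f = v'" "amap F f = x"
    using assms(2) by (auto simp: Fwd step_Fwd)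
  then have "x \<in> arcs (hat E w)" "head (hat E w) x = vmap F v'"
    using assms(1) unfolding graph_hom_def by blast+
  then show ?thesis by (simp add: Fwd double_def)
next
  case (Rev x)
  obtain f where "f \<in> arcs (gr F)" "tail (gr F) f = v'" "amap F f = x"
    using assms(2) by (auto simp: Rev step_Rev)
  then have "x \<in> arcs (hat E w)" "tail (hat E w) x = vmap F v'"
    using assms(1) unfolding graph_hom_def by blast+
  then show ?thesis by (simp add: Rev double_def)
qed

lemma run_labels:
  assumes "graph_hom (gr F) (hat E w) (vmap F) (amap F)" "run F v ys v'"
  shows "set ys \<subseteq> arcs (double (hat E w))"
  using assms(2)
proof (induction ys arbitrary: v)
  case (Cons y ys)
  then obtain m where "step F v y m" "run F m ys v'" by auto
  then show ?case using Cons.IH step_hom[OF assms(1)] by simp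
qed simp

lemma run_awlast:
  assumes "graph_hom (gr F) (hat E w) (vmap F) (amap F)" "run F v ys v'"
  shows "pre_digraph.awlast (double (hat E w)) (vmap F v) ys = vmap F v'"
  using assms(2)
proof (induction ys arbitrary: v)
  case Nil
  then show ?case by (simp add: pre_digraph.awalk_verts.simps)
next
  case (Cons y ys)
  then obtain m where m: "step F v y m" "run F m ys v'" by auto
  have "pre_digraph.awalk_verts (double (hat E w)) a zs \<noteq> []" for a zs
    by (cases zs) (simp_all add: pre_digraph.awalk_verts.simps)
  then show ?case
    using Cons.IH[OF m(2)] step_hom[OF assms(1) m(1)]
    by (simp add: pre_digraph.awalk_verts.simps)
qed

context
  fixes E :: "('v, 'e) pre_digraph" and w :: "'e \<Rightarrow> nat"
    and F :: "('a, 'b, 'v, 'e) repgraph" and u :: 'a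
  assumes E: "weighted_graph E w" and F: "representation_graph E w F" and u: "u \<in> verts (gr F)"
begin

private abbreviation (input) "P \<equiv> reduced_image E w F u"
private abbreviation (input) "T \<equiv> tree_rep E w F u"

lemma mem_reduced_image_iff:
  "(a, xs) \<in> P \<longleftrightarrow>
     a = vmap F u \<and> (\<exists>v. run F u xs v) \<and> reduced (hat E w) (a, xs)"
  using mem_path_image_iff[OF representation_graphD(1)[OF E F]]
  by (auto simp: reduced_image_def)

lemma Nil_mem_reduced_image: "(vmap F u, []) \<in> P"
  using u by (simp add: mem_reduced_image_iff reduced_def)

lemma snoc_mem_reduced_image_iff:
  "(a, xs @ [y]) \<in> P \<longleftrightarrow>
     (a, xs) \<in> P \<and> (\<exists>v v'. run F u xs v \<and> step F v y v') \<and> \<not> (xs \<noteq> [] \<and> last xs = flip y)"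
proof -
  note wf = representation_graphD(1)[OF E F]
  have "reduced (hat E w) (a, xs @ [y]) \<longleftrightarrow>
      reduced (hat E w) (a, xs) \<and> \<not> (xs \<noteq> [] \<and> last xs = flip y)" if "run F u xs v" for v
    using run_labels[OF representation_graphD(2)[OF E F] that]
    by (intro reduced_snoc_iff) (auto simp: double_def)
  then show ?thesis
    unfolding mem_reduced_image_iff run_append[OF wf] run_single[OF wf] by blast
qed

lemma endpoint_run: "p \<in> P \<Longrightarrow> run F u (snd p) (endpoint F u p)"
  using endpoint_eq[OF representation_graphD(3)[OF E F]]
  by (cases p) (auto simp: mem_reduced_image_iff)

lemma verts_tree: "verts (gr T) = P"
  by (simp add: tree_rep_def)

lemma tree_arcE:
  assumes "f \<in> arcs (gr T)"
  obtains a zs z where "f = (a, zs @ [z])" "(a, zs @ [z]) \<in> P" "(a, zs) \<in> P"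
proof -
  obtain a xs where f: "f = (a, xs)" by (cases f)
  then have "(a, xs) \<in> P" "xs \<noteq> []" using assms by (auto simp: tree_rep_def mem_reduced_image_iff)
  then show thesis
    using that f snoc_mem_reduced_image_iff by (cases xs rule: rev_cases) auto
qed

lemma snoc_tree_arc: "(a, zs @ [z]) \<in> P \<Longrightarrow> (a, zs @ [z]) \<in> arcs (gr T)"
  by (simp add: tree_rep_def)

lemma tree_arc_simps:
  "tail (gr T) (a, zs @ [Fwd x]) = (a, zs)" "head (gr T) (a, zs @ [Fwd x]) = (a, zs @ [Fwd x])"
  "tail (gr T) (a, zs @ [Rev x]) = (a, zs @ [Rev x])" "head (gr T) (a, zs @ [Rev x]) = (a, zs)"
  "amap T (a, zs @ [Fwd x]) = x" "amap T (a, zs @ [Rev x]) = x"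
  by (simp_all add: tree_rep_def)

text \<open>Every edge of the tree appends a letter when read in one direction and deletes it when read in
  the other. Reading \<open>y\<close> at \<open>p\<close> therefore appends \<open>y\<close>, or cancels a final letter \<open>flip y\<close>.\<close>

lemma tree_step_iff:
  "step T (a, xs) y (b, ys) \<longleftrightarrow>
     a = b \<and> ((b, ys) \<in> P \<and> ys = xs @ [y] \<or> (a, xs) \<in> P \<and> xs = ys @ [flip y])"
    (is "_ \<longleftrightarrow> ?R")
proof
  assume "step T (a, xs) y (b, ys)"
  then obtain f x where f: "f \<in> arcs (gr T)"
    and y: "y = Fwd x \<and> tail (gr T) f = (a, xs) \<and> head (gr T) f = (b, ys) \<and> amap T f = x \<or>
      y = Rev x \<and> head (gr T) f = (a, xs) \<and> tail (gr T) f = (b, ys) \<and> amap T f = x"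
    by (cases y) (auto simp: step_Fwd step_Rev)
  obtain c zs z where z: "f = (c, zs @ [z])" "(c, zs @ [z]) \<in> P" using tree_arcE[OF f] .
  show ?R using y z by (cases z) (auto simp: tree_arc_simps)
next
  assume R: ?R
  then consider "a = b" "(a, xs @ [y]) \<in> P" "ys = xs @ [y]"
    | "a = b" "(a, ys @ [flip y]) \<in> P" "xs = ys @ [flip y]" by blast
  then show "step T (a, xs) y (b, ys)"
  proof cases
    case 1
    then show ?thesis
      using snoc_tree_arc[OF 1(2)]
      by (cases y) (auto simp: step_Fwd step_Rev tree_arc_simps intro!: bexI[of _ "(a, xs @ [y])"])
  next
    case 2
    then show ?thesis
      using snoc_tree_arc[OF 2(2)]
      by (cases y)
        (auto simp: step_Fwd step_Rev tree_arc_simps intro!: bexI[of _ "(a, ys @ [flip y])"])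
  qed
qed

lemma tree_wf: "wf_digraph (gr T)"
proof (rule wf_digraph.intro)
  fix f assume "f \<in> arcs (gr T)"
  then obtain a zs z where "f = (a, zs @ [z])" "(a, zs @ [z]) \<in> P" "(a, zs) \<in> P"
    by (rule tree_arcE)
  then show "tail (gr T) f \<in> verts (gr T)" "head (gr T) f \<in> verts (gr T)"
    unfolding verts_tree by (cases z; simp add: tree_arc_simps)+
qed

text \<open>Two edges of the same kind, both ending in a \<open>Fwd\<close> or both in a \<open>Rev\<close> letter, are told apart
  by their ends and labels. Two edges of different kinds with a common source or a common target and
  the same label would force one of the two words to end in a backtracking pair, and such words are
  not reduced.\<close>

lemma tree_faithful: "faithful T"
  unfolding faithful_def
proof (intro ballI impI)
  fix f g assume "f \<in> arcs (gr T)" "g \<in> arcs (gr T)"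
    and eq: "amap T f = amap T g \<and> (tail (gr T) f = tail (gr T) g \<or> head (gr T) f = head (gr T) g)"
  then obtain a zs z b ys y where f: "f = (a, zs @ [z])" "(a, zs @ [z]) \<in> P"
    and g: "g = (b, ys @ [y])" "(b, ys @ [y]) \<in> P"
    by (metis tree_arcE)
  have "(c, (xs @ [flip x]) @ [x]) \<notin> P" for c xs x
    unfolding snoc_mem_reduced_image_iff by simp
  from this[of _ _ "Fwd _"] this[of _ _ "Rev _"]
  have no: "(c, xs @ [Rev x, Fwd x]) \<notin> P" "(c, xs @ [Fwd x, Rev x]) \<notin> P" for c xs x
    by simp_all
  show "f = g"
    using eq f g no
    by (cases z; cases y) (auto simp: tree_arc_simps)
qed

text \<open>A letter \<open>y\<close> that can be read at the end of the reduced word \<open>p\<close> either cancels the last letter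
  of \<open>p\<close> or extends \<open>p\<close> to a longer reduced word; in both cases it can be read at \<open>p\<close> in the
  tree.\<close>

lemma tree_covering: "covering T F (endpoint F u)"
  unfolding covering_def
proof (intro conjI ballI allI impI)
  note wf = representation_graphD(1)[OF E F] and hom = representation_graphD(2)[OF E F]
  fix p assume "p \<in> verts (gr T)"
  then have p: "p \<in> P" by (simp add: verts_tree)
  show "endpoint F u p \<in> verts (gr F)" using run_verts(2)[OF wf endpoint_run[OF p]] .
  show "vmap F (endpoint F u p) = vmap T p"
    using run_awlast[OF hom endpoint_run[OF p]] p
    by (cases p) (auto simp: tree_rep_def mem_reduced_image_iff)
  show "\<exists>p'. step T p y p'" if y: "step F (endpoint F u p) y m" for y m
  proof -
    obtain a xs where xs: "p = (a, xs)" by (cases p)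
    show ?thesis
    proof (cases "xs \<noteq> [] \<and> last xs = flip y")
      case True
      then have "xs = butlast xs @ [flip y]" by (metis append_butlast_last_id)
      then have "step T p y (a, butlast xs)" using p xs by (simp add: tree_step_iff)
      then show ?thesis by blast
    next
      case False
      then have "(a, xs @ [y]) \<in> P"
        using p xs y endpoint_run[OF p] unfolding snoc_mem_reduced_image_iff by auto
      then have "step T p y (a, xs @ [y])" using xs by (simp add: tree_step_iff)
      then show ?thesis by blast
    qed
  qed
next
  note wf = representation_graphD(1)[OF E F] and det = representation_graphD(3)[OF E F]
  have ext: "step F (endpoint F u (a, xs)) y (endpoint F u (a, xs @ [y]))"
    if xs: "(a, xs @ [y]) \<in> P" for a xs y
  proof -
    have "run F u (xs @ [y]) (endpoint F u (a, xs @ [y]))" using endpoint_run[OF xs] by simp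
    then obtain m where m: "run F u xs m" "step F m y (endpoint F u (a, xs @ [y]))"
      unfolding run_append[OF wf] run_single[OF wf] by blast
    then show ?thesis using endpoint_eq[OF det m(1)] by simp
  qed
  fix p y p' assume s: "step T p y p'"
  obtain a xs b ys where p: "p = (a, xs)" "p' = (b, ys)" by (cases p; cases p')
  from s consider "a = b" "(a, xs @ [y]) \<in> P" "ys = xs @ [y]"
    | "a = b" "(a, ys @ [flip y]) \<in> P" "xs = ys @ [flip y]"
    unfolding p tree_step_iff by blast
  then show "step F (endpoint F u p) y (endpoint F u p')"
  proof cases
    case 1
    then show ?thesis using ext[OF 1(2)] p by simp
  next
    case 2
    then show ?thesis using step_flip[OF ext[OF 2(2)]] p by simp
  qed
qed

text \<open>The word \<open>p\<close> itself leads from the root to the vertex \<open>p\<close>. Hence the tree is connected.\<close>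

lemma tree_run: "(a, xs) \<in> P \<Longrightarrow> run T (vmap F u, []) xs (a, xs)"
proof (induction xs rule: rev_induct)
  case Nil
  then show ?case using Nil_mem_reduced_image by (simp add: verts_tree mem_reduced_image_iff)
next
  case (snoc y xs)
  then have "run T (vmap F u, []) xs (a, xs)" using snoc_mem_reduced_image_iff by blast
  moreover have "step T (a, xs) y (a, xs @ [y])" using snoc.prems by (simp add: tree_step_iff)
  ultimately show ?case unfolding run_append[OF tree_wf] run_single[OF tree_wf] by blast
qed

lemma tree_representation_graph: "representation_graph E w T"
  by (rule representation_graph_of_covering[OF E tree_covering F tree_wf tree_faithful])

lemma tree_connected: "connected_graph (gr T)"
  by (rule connected_graphI[OF tree_wf, of "(vmap F u, [])"]) (use tree_run verts_tree in auto)

lemma tree_path_image: "path_image T (vmap F u, []) = path_image F u"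
proof -
  have "endpoint F u (vmap F u, []) = u"
    by (rule endpoint_eq[OF representation_graphD(3)[OF E F]]) (simp add: u)
  then show ?thesis
    using covering_path_image[OF tree_covering tree_wf representation_graphD(1,3)[OF E F],
        of "(vmap F u, [])"] Nil_mem_reduced_image by (simp add: verts_tree)
qed

end

section \<open>The equivalence class and its irreducible member\<close>

text \<open>The vertex \<open>u\<close> may be prescribed in a connected graph: move from the vertex given by the
  equivalence to \<open>u\<close>, copy the same word in \<open>G\<close>, and compare the residual path images. This also
  yields transitivity of \<open>\<leftrightharpoons>\<close> across graphs of different types.\<close>

lemma rep_equiv_transport:
  assumes "weighted_graph E w" "F \<in> RG E w" "G \<in> RG E w" "F \<leftrightharpoons> G" "u \<in> verts (gr F)"
  shows "\<exists>v\<in>verts (gr G). path_image F u = path_image G v"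
proof -
  have reps: "representation_graph E w F" "representation_graph E w G" "connected_graph (gr F)"
    using assms(2,3) by (auto simp: RG_def)
  note F = representation_graphD[OF assms(1) reps(1)]
    and G = representation_graphD[OF assms(1) reps(2)]
  obtain u0 v0 where u0: "u0 \<in> verts (gr F)" "v0 \<in> verts (gr G)"
    "path_image F u0 = path_image G v0"
    using assms(4) unfolding rep_equiv_def by blast
  have "\<exists>v\<in>verts (gr G). path_image F u = path_image G v"
    if "run F a ys u" "b \<in> verts (gr G)" "path_image F a = path_image G b" for a b ys
    using that
  proof (induction ys arbitrary: a b)
    case (Cons y ys)
    then obtain m where m: "step F a y m" "run F m ys u" by auto
    have "\<exists>n. run G b [y] n"
      using Cons.prems(3) m(1) run_single[OF F(1)]
      unfolding path_image_eq_iff[OF F(1) G(1) step_verts(1)[OF F(1) m(1)]] by blast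
    then obtain n where n: "step G b y n" unfolding run_single[OF G(1)] by blast
    have "path_image F m = path_image G n"
      by (rule path_image_residual[OF F(1,3) G(1,3) F(2) G(2) Cons.prems(3) m(1) n])
    then show ?case using Cons.IH[OF m(2) step_verts(2)[OF G(1) n]] by blast
  qed auto
  moreover obtain ys where "run F u0 ys u"
    using reps(3) u0(1) assms(5) unfolding connected_graph_iff_run[OF F(1)] by blast
  ultimately show ?thesis using u0 by blast
qed

lemma rep_equiv_sym: "F \<leftrightharpoons> G \<Longrightarrow> G \<leftrightharpoons> F"
  unfolding rep_equiv_def by metis

text \<open>The representative of \<open>C\<close>, \<open>F\<close> and the graph that puts \<open>G\<close> into the class are linked by
  \<open>\<leftrightharpoons>\<close>; transporting \<open>u\<close> along these links ends at the required vertex of \<open>G\<close>.\<close>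

lemma class_members_iff:
  assumes "weighted_graph E w" "C \<in> RG E w // rep_equiv_rel E w" "F \<in> C" "u \<in> verts (gr F)"
  shows "F \<in> RG E w"
    and "G \<in> class_members E w C \<longleftrightarrow>
      G \<in> RG E w \<and> (\<exists>v\<in>verts (gr G). path_image F u = path_image G v)"
proof -
  obtain X where X: "C = rep_equiv_rel E w `` {X}" using assms(2) by (auto elim: quotientE)
  have C: "H \<in> RG E w \<and> X \<in> RG E w \<and> X \<leftrightharpoons> H" if "H \<in> C" for H
    using that unfolding X rep_equiv_rel_def by auto
  then show F: "F \<in> RG E w" using assms(3) by blast
  show "G \<in> class_members E w C \<longleftrightarrow>
      G \<in> RG E w \<and> (\<exists>v\<in>verts (gr G). path_image F u = path_image G v)"
  proof
    assume "G \<in> class_members E w C"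
    then obtain H where G: "G \<in> RG E w" and H: "H \<in> C" "H \<leftrightharpoons> G"
      unfolding class_members_def by blast
    obtain x where x: "x \<in> verts (gr X)" "path_image F u = path_image X x"
      using rep_equiv_transport[OF assms(1) F _ rep_equiv_sym assms(4)] C[OF assms(3)] by blast
    obtain h where h: "h \<in> verts (gr H)" "path_image X x = path_image H h"
      using rep_equiv_transport[OF assms(1) _ _ _ x(1)] C[OF H(1)] by blast
    obtain v where "v \<in> verts (gr G)" "path_image H h = path_image G v"
      using rep_equiv_transport[OF assms(1) _ G H(2) h(1)] C[OF H(1)] by blast
    then show "G \<in> RG E w \<and> (\<exists>v\<in>verts (gr G). path_image F u = path_image G v)"
      using G x(2) h(2) by auto
  next
    assume "G \<in> RG E w \<and> (\<exists>v\<in>verts (gr G). path_image F u = path_image G v)"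
    then show "G \<in> class_members E w C"
      using assms(3,4) unfolding class_members_def rep_equiv_def by blast
  qed
qed

text \<open>Coverings preserve path images, so vertices in the same fibre are always similar. Conversely
  similar vertices have images with the same path image, and these coincide in an irreducible graph.\<close>

lemma fibre_rel_eq_sim:
  assumes "covering F G \<alpha>" "wf_digraph (gr F)" "wf_digraph (gr G)" "faithful G"
    "irreducible_rep G"
  shows "fibre_rel F \<alpha> = sim F"
proof
  show "fibre_rel F \<alpha> \<subseteq> sim F"
    using fibre_rel_admissible[OF assms(1-4)] unfolding admissible_def by blast
  show "sim F \<subseteq> fibre_rel F \<alpha>"
  proof (rule subrelI)
    fix p q assume "(p, q) \<in> sim F"
    then have pq: "p \<in> verts (gr F)" "q \<in> verts (gr F)" "path_image F p = path_image F q"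
      by (auto simp: sim_def)
    then have "path_image G (\<alpha> p) = path_image G (\<alpha> q)"
      using covering_path_image[OF assms(1-4)] by metis
    then have "\<alpha> p = \<alpha> q"
      using assms(5) coveringD(1)[OF assms(1)] pq unfolding irreducible_rep_def by blast
    then show "(p, q) \<in> fibre_rel F \<alpha>" using pq by (simp add: fibre_rel_def)
  qed
qed

lemma quotient_RG:
  assumes "weighted_graph E w" "F \<in> RG E w" "admissible F R"
  shows "quotient_rep F R \<in> RG E w"
    and "v \<in> verts (gr F) \<Longrightarrow> path_image (quotient_rep F R) (R `` {v}) = path_image F v"
proof -
  have F: "representation_graph E w F" "verts (gr F) \<noteq> {}" "connected_graph (gr F)"
    using assms(2) by (auto simp: RG_def)
  note rep = representation_graphD[OF assms(1) F(1)]
  note Q = quotient_wf_faithful[OF rep(1,3) assms(3)] and cov = quotient_covering[OF rep(1) assms(3)]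
  have "representation_graph E w (quotient_rep F R)"
    by (rule representation_graph_of_covered[OF assms(1) cov verts_quotient[symmetric] F(1) Q])
  moreover have "connected_graph (gr (quotient_rep F R))"
    by (rule connected_covered[OF cov verts_quotient[symmetric] rep(1) Q(1) F(3)])
  ultimately show "quotient_rep F R \<in> RG E w" using F(2) by (simp add: RG_def verts_quotient)
  show "path_image (quotient_rep F R) (R `` {v}) = path_image F v" if "v \<in> verts (gr F)"
    using covering_path_image[OF cov rep(1) Q that] by simp
qed

text \<open>The projection preserves path images, so distinct classes of \<open>sim F\<close> keep distinct path images.\<close>

lemma quotient_sim_irreducible:
  assumes "weighted_graph E w" "F \<in> RG E w"
  shows "irreducible_rep (quotient_rep F (sim F))"
proof -
  have "representation_graph E w F" using assms(2) by (simp add: RG_def)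
  note adm = sim_admissible[OF assms(1) this]
  note Q = quotient_RG[OF assms adm]
  have "connected_graph (gr (quotient_rep F (sim F)))" using Q(1) by (simp add: RG_def)
  moreover have "sim F `` {p} = sim F `` {q}"
    if pq: "p \<in> verts (gr F)" "q \<in> verts (gr F)"
      and eq: "path_image (quotient_rep F (sim F)) (sim F `` {p}) =
        path_image (quotient_rep F (sim F)) (sim F `` {q})" for p q
  proof (rule equiv_class_eq[OF admissible_equiv[OF adm]])
    show "(p, q) \<in> sim F" using pq eq Q(2) by (simp add: sim_def)
  qed
  ultimately show ?thesis unfolding irreducible_rep_def verts_quotient by blast
qed

theorem corollary15:
  fixes E :: "('v, 'e) pre_digraph" and w :: "'e \<Rightarrow> nat"
    and C :: "('a, 'b, 'v, 'e) repgraph set"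
    and F :: "('a, 'b, 'v, 'e) repgraph" and u :: 'a
  defines "T \<equiv> tree_rep E w F u"
  defines "S \<equiv> quotient_rep T (sim T)"
  assumes "weighted_graph E w"
    and "C \<in> RG E w // rep_equiv_rel E w"
    and "F \<in> C"
    and "u \<in> verts (gr F)"
  shows "(\<forall>G :: ('c, 'd, 'v, 'e) repgraph. G \<in> class_members E w C \<longrightarrow>
            (\<exists>Q\<in>quotients T. rep_iso G Q)) \<and>
         quotients T \<subseteq> class_members E w C \<and>
         S \<in> class_members E w C \<and> irreducible_rep S \<and>
         (\<forall>G :: ('c, 'd, 'v, 'e) repgraph.
            G \<in> class_members E w C \<and> irreducible_rep G \<longrightarrow> rep_iso G S)"
proof -
  note E = assms(3) and member_iff = class_members_iff(2)[OF assms(3-6)]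
  have F: "representation_graph E w F"
    using class_members_iff(1)[OF assms(3-6)] by (simp add: RG_def)
  note wfF = representation_graphD(1)[OF E F]
  have root: "(vmap F u, []) \<in> verts (gr T)"
    using Nil_mem_reduced_image[OF E F assms(6)] unfolding T_def verts_tree[OF E F assms(6)] .
  have T: "representation_graph E w T" "wf_digraph (gr T)" "faithful T" "T \<in> RG E w"
    using tree_representation_graph[OF E F assms(6)] tree_connected[OF E F assms(6)]
      tree_wf[OF E F assms(6)] tree_faithful[OF E F assms(6)] root
    by (auto simp: RG_def T_def)
  have quotient_member: "quotient_rep T R \<in> class_members E w C" if R: "admissible T R" for R
  proof -
    note Q = quotient_RG[OF E T(4) R]
    have "path_image F u = path_image (quotient_rep T R) (R `` {(vmap F u, [])})"
      using Q(2)[OF root] tree_path_image[OF E F assms(6)] unfolding T_def by simp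
    moreover have "R `` {(vmap F u, [])} \<in> verts (gr (quotient_rep T R))"
      using root unfolding verts_quotient by blast
    ultimately show ?thesis using Q(1) unfolding member_iff by blast
  qed
  have sim: "admissible T (sim T)" by (rule sim_admissible[OF E T(1)])
  have covers: "\<exists>\<alpha>. covering T G \<alpha> \<and> wf_digraph (gr G) \<and> faithful G \<and>
      rep_iso G (quotient_rep T (fibre_rel T \<alpha>))"
    if member: "G \<in> class_members E w C" for G :: "('c, 'd, 'v, 'e) repgraph"
  proof -
    obtain v where G: "G \<in> RG E w" and v: "v \<in> verts (gr G)" "path_image F u = path_image G v"
      using member unfolding member_iff by blast
    have rep: "representation_graph E w G" and conn: "connected_graph (gr G)"
      using G by (auto simp: RG_def)
    note repG = representation_graphD[OF E rep]
    \<comment> \<open>\<open>G\<close> and \<open>F\<close> have the same tree, so the covering onto \<open>G\<close> is that of its own tree.\<close>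
    have "T = tree_rep E w G v" unfolding T_def by (rule tree_rep_cong[OF wfF repG(1) assms(6) v(2)])
    then have cov: "covering T G (endpoint G v)" using tree_covering[OF E rep v(1)] by simp
    have "rep_iso G (quotient_rep T (fibre_rel T (endpoint G v)))"
      by (rule covered_iso_quotient[OF cov T(2,3) repG(1,3)
            covering_surj[OF cov T(2) repG(1,3) root conn]])
    then show ?thesis using cov repG by blast
  qed
  have "\<exists>Q\<in>quotients T. rep_iso G Q" if "G \<in> class_members E w C"
    for G :: "('c, 'd, 'v, 'e) repgraph"
    using covers[OF that] fibre_rel_admissible[OF _ T(2)] unfolding quotients_def by blast
  moreover have "quotients T \<subseteq> class_members E w C"
    using quotient_member unfolding quotients_def by blast
  moreover have "S \<in> class_members E w C" unfolding S_def by (rule quotient_member[OF sim])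
  moreover have "irreducible_rep S" unfolding S_def by (rule quotient_sim_irreducible[OF E T(4)])
  moreover have "rep_iso G S" if "G \<in> class_members E w C" "irreducible_rep G"
    for G :: "('c, 'd, 'v, 'e) repgraph"
    using covers[OF that(1)] fibre_rel_eq_sim[OF _ T(2) _ _ that(2)] unfolding S_def by metis
  ultimately show ?thesis by blast
qed

end
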